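(* Let $V$ be a module over a $C^*$-algebra $A$, let $B$ be a unital $C^*$-algebra, and let $E: B\to S_A(V)$ be a completely positive mapping. Then there exist a Hilbert $C^*$-module $M$ over $A$, a unital *-homomorphism $\pi: B\to L_A(M)$, and an element $J\in\mathrm{Lin}_A(V,M)$ such that (i) $E(b)(v,v')=\langle v,J^\times\pi(b)Jv'\rangle=\langle Jv\,|\,\pi(b)Jv'\rangle$ for all $b\in B$, $v,v'\in V$; (ii) the $\mathbb C$-linear span of $\{\pi(b)Jv : b\in B,\ v\in V\}$ is dense in $M$. A triple $(M,\pi,J)$ with these properties is called a minimal dilation for $E$. If $(M',\pi',J')$ is another minimal dilation for $E$, then there is a unitary mapping $U: M\to M'$ such that $\pi'(b)=U\pi(b)U^*$ for all $b\in B$, and $J'=UJ$.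
   Context: All vector spaces and algebras are over $\mathbb C$; $C^*$-algebras need not be unital unless stated. A (right) module $V$ over an algebra $A$ ($A$-module) is a vector space with a map $V\times A\to V$, $(v,a)\mapsto v\cdot a$, additive in each variable, with $v\cdot(aa')=(v\cdot a)\cdot a'$, $c(v\cdot a)=(cv)\cdot a=v\cdot(ca)$ for $c\in\mathbb C$, and $v\cdot e=v$ if $A$ has an identity $e$. No inner product or topology on $V$ is assumed. $\mathrm{Lin}_A(V,W)$ is the set of $\mathbb C$-linear maps $f:V\to W$ between $A$-modules with $f(v\cdot a)=f(v)\cdot a$. $L_A(M)$ is the $C^*$-algebra of adjointable maps of a Hilbert $A$-module $M$ into itself. $S_A(V)$ is the vector space of $A$-sesquilinear maps $s:V\times V\to A$: $s$ is $\mathbb C$-antilinear in the first and $\mathbb C$-linear in the second argument, and $s(v,v'\cdot a)=s(v,v')a$, $s(v\cdot a,v')=a^*s(v,v')$. A mapping $E:B\to S_A(V)$ is completely positive if it is $\mathbb C$-linear and, for every $n\in\mathbb N$, every positive $(b_{ij})_{i,j=1}^n\in M_n(B)$ and all $v_1,\dots,v_n\in V$, the matrix $\big(E(b_{ij})(v_i,v_j)\big)_{i,j=1}^n$ is a positive element of $M_n(A)$. Inner products on Hilbert $C^*$-modules over $A$ are $A$-valued, linear and $A$-linear in the second argument: $\langle m|m'\cdot a\rangle=\langle m|m'\rangle a$, $\langle m|m'\rangle=\langle m'|m\rangle^*$. A unitary between Hilbert $A$-modules is a surjective $A$-linear map preserving the inner products; $U^*=U^{-1}$ is its adjoint. $V^\times_A$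 denotes the space of $A$-antilinear maps $f:V\to A$ ($\mathbb C$-antilinear with $f(v\cdot a)=a^*f(v)$), and $\langle v,f\rangle:=f(v)$. For $J\in\mathrm{Lin}_A(V,M)$ the map $J^\times:M\to V_A^\times$ is defined by $\langle v,J^\times m\rangle:=\langle Jv|m\rangle$ for $v\in V$, $m\in M$. *)

theory Defs
  imports
    "HOL-Analysis.Analysis"
    "HOL-Library.Function_Algebras"
    "Jordan_Normal_Form.Matrix"
begin

section \<open>Complex vector spaces and C*-algebras\<close>

class complex_vector = ab_group_add +
  fixes scaleC :: "complex \<Rightarrow> 'a \<Rightarrow> 'a" (infixr \<open>*\<^sub>C\<close> 75)
  assumes scaleC_add_right: "c *\<^sub>C (x + y) = c *\<^sub>C x + c *\<^sub>C y"
    and scaleC_add_left: "(c + d) *\<^sub>C x = c *\<^sub>C x + d *\<^sub>C x"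
    and scaleC_scaleC: "c *\<^sub>C (d *\<^sub>C x) = (c * d) *\<^sub>C x"
    and scaleC_one: "1 *\<^sub>C x = x"

interpretation complex_vector: vector_space "scaleC :: complex \<Rightarrow> 'a \<Rightarrow> 'a::complex_vector"
  by unfold_locales (simp_all add: scaleC_add_right scaleC_add_left scaleC_scaleC scaleC_one)

instantiation "fun" :: (type, complex_vector) complex_vector
begin

definition scaleC_fun :: "complex \<Rightarrow> ('a \<Rightarrow> 'b) \<Rightarrow> 'a \<Rightarrow> 'b"
  where "scaleC_fun c f = (\<lambda>x. c *\<^sub>C f x)"

instance
  by standard
    (simp_all add: scaleC_fun_def fun_eq_iff scaleC_add_right scaleC_add_left scaleC_scaleC scaleC_one)

end

text \<open>
  No identity is assumed. The underlying real Banach algebra supplies completeness and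
  submultiplicativity of the norm.
\<close>

class cstar_algebra = complex_vector + real_normed_algebra + banach +
  fixes star :: "'a \<Rightarrow> 'a"
  assumes scaleR_eq_scaleC: "r *\<^sub>R x = complex_of_real r *\<^sub>C x"
    and norm_scaleC: "norm (c *\<^sub>C x) = cmod c * norm x"
    and mult_scaleC_left: "(c *\<^sub>C x) * y = c *\<^sub>C (x * y)"
    and mult_scaleC_right: "x * (c *\<^sub>C y) = c *\<^sub>C (x * y)"
    and star_star: "star (star x) = x"
    and star_add: "star (x + y) = star x + star y"
    and star_scaleC: "star (c *\<^sub>C x) = cnj c *\<^sub>C star x"
    and star_mult: "star (x * y) = star y * star x"
    and cstar_identity: "norm (star x * x) = (norm x)\<^sup>2"

text \<open>
  Since \<open>0 \<noteq> 1\<close> is not required, the zero algebra is included.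
\<close>

class unital_cstar_algebra = cstar_algebra + monoid_mult

text \<open>
  An element of a C*-algebra is positive if it has the form \<open>x\<^sup>* x\<close>. The matrix algebra
  \<open>M\<^sub>n(A)\<close> consists of the \<open>n \<times> n\<close> matrices with the usual product and the involution
  \<open>(a\<^sub>i\<^sub>j)\<^sup>* = (a\<^sub>j\<^sub>i\<^sup>*)\<close>; its C*-norm plays no role in positivity.
\<close>

definition positive_elem :: "'a::cstar_algebra \<Rightarrow> bool"
  where "positive_elem a \<longleftrightarrow> (\<exists>x. a = star x * x)"

definition mat_star :: "'a::cstar_algebra mat \<Rightarrow> 'a mat"
  where "mat_star X = transpose_mat (map_mat star X)"

definition positive_mat :: "nat \<Rightarrow> 'a::cstar_algebra mat \<Rightarrow> bool"
  where "positive_mat n P \<longleftrightarrow> (\<exists>X \<in> carrier_mat n n. P = mat_star X * X)"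


section \<open>Modules over a C*-algebra\<close>

text \<open>
  A module is carried by a complex-linear subspace \<open>V\<close> of a type; the action is
  unconstrained outside \<open>V\<close>.
\<close>

locale cstar_module =
  fixes V :: "'v::complex_vector set"
    and act :: "'v \<Rightarrow> 'a::cstar_algebra \<Rightarrow> 'v"
  assumes subspace: "complex_vector.subspace V"
    and act_closed: "v \<in> V \<Longrightarrow> act v a \<in> V"
    and act_add_left: "v \<in> V \<Longrightarrow> w \<in> V \<Longrightarrow> act (v + w) a = act v a + act w a"
    and act_add_right: "v \<in> V \<Longrightarrow> act v (a + a') = act v a + act v a'"
    and act_mult: "v \<in> V \<Longrightarrow> act v (a * a') = act (act v a) a'"
    and act_scaleC_left: "v \<in> V \<Longrightarrow> act (c *\<^sub>C v) a = c *\<^sub>C act v a"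
    and act_scaleC_right: "v \<in> V \<Longrightarrow> act v (c *\<^sub>C a) = c *\<^sub>C act v a"
    and act_identity: "(\<And>a. e * a = a \<and> a * e = a) \<Longrightarrow> v \<in> V \<Longrightarrow> act v e = v"

definition Lin :: "'v::complex_vector set \<Rightarrow> ('v \<Rightarrow> 'a::cstar_algebra \<Rightarrow> 'v) \<Rightarrow>
    'w::complex_vector set \<Rightarrow> ('w \<Rightarrow> 'a \<Rightarrow> 'w) \<Rightarrow> ('v \<Rightarrow> 'w) set"
  where "Lin V actV W actW = {f \<in> V \<rightarrow> W.
    (\<forall>v\<in>V. \<forall>v'\<in>V. f (v + v') = f v + f v') \<and>
    (\<forall>c. \<forall>v\<in>V. f (c *\<^sub>C v) = c *\<^sub>C f v) \<and>
    (\<forall>v\<in>V. \<forall>a. f (actV v a) = actW (f v) a)}"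

definition sesquilinear_maps ::
    "('v::complex_vector \<Rightarrow> 'a::cstar_algebra \<Rightarrow> 'v) \<Rightarrow> ('v \<Rightarrow> 'v \<Rightarrow> 'a) set"
  where "sesquilinear_maps act = {s.
    (\<forall>v v' w. s (v + v') w = s v w + s v' w) \<and>
    (\<forall>c v w. s (c *\<^sub>C v) w = cnj c *\<^sub>C s v w) \<and>
    (\<forall>v w w'. s v (w + w') = s v w + s v w') \<and>
    (\<forall>c v w. s v (c *\<^sub>C w) = c *\<^sub>C s v w) \<and>
    (\<forall>v w a. s v (act w a) = s v w * a) \<and>
    (\<forall>v w a. s (act v a) w = star a * s v w)}"

definition completely_positive ::
    "('v::complex_vector \<Rightarrow> 'a::cstar_algebra \<Rightarrow> 'v) \<Rightarrow>
     ('b::cstar_algebra \<Rightarrow> 'v \<Rightarrow> 'v \<Rightarrow> 'a) \<Rightarrow> bool"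
  where "completely_positive act E \<longleftrightarrow>
    (\<forall>b. E b \<in> sesquilinear_maps act) \<and>
    (\<forall>b b'. E (b + b') = E b + E b') \<and>
    (\<forall>c b. E (c *\<^sub>C b) = c *\<^sub>C E b) \<and>
    (\<forall>n. \<forall>P \<in> carrier_mat n n. \<forall>v :: nat \<Rightarrow> 'v.
      positive_mat n P \<longrightarrow> positive_mat n (mat n n (\<lambda>(i, j). E (P $$ (i, j)) (v i) (v j))))"

definition antidual ::
    "('v::complex_vector \<Rightarrow> 'a::cstar_algebra \<Rightarrow> 'v) \<Rightarrow> ('v \<Rightarrow> 'a) set"
  where "antidual act = {f.
    (\<forall>v v'. f (v + v') = f v + f v') \<and>
    (\<forall>c v. f (c *\<^sub>C v) = cnj c *\<^sub>C f v) \<and>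
    (\<forall>v a. f (act v a) = star a * f v)}"

definition pairing :: "'v \<Rightarrow> ('v \<Rightarrow> 'a) \<Rightarrow> 'a"
  where "pairing v f = f v"


section \<open>Hilbert C*-modules\<close>

text \<open>
  The distance induced by the norm \<open>\<parallel>\<langle>x | x\<rangle>\<parallel>\<^sup>1\<^sup>/\<^sup>2\<close>. It is set to \<open>0\<close> off \<open>M\<close>, where \<open>ip\<close> is
  unconstrained, because \<^locale>\<open>Metric_space\<close> asks for symmetry on the whole type.
\<close>

definition hilbert_dist ::
    "'m::complex_vector set \<Rightarrow> ('m \<Rightarrow> 'm \<Rightarrow> 'a::cstar_algebra) \<Rightarrow> 'm \<Rightarrow> 'm \<Rightarrow> real"
  where "hilbert_dist M ip x y =
    (if x \<in> M \<and> y \<in> M then sqrt (norm (ip (x - y) (x - y))) else 0)"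

locale hilbert_module = cstar_module M act
  for M :: "'m::complex_vector set" and act :: "'m \<Rightarrow> 'a::cstar_algebra \<Rightarrow> 'm" +
  fixes ip :: "'m \<Rightarrow> 'm \<Rightarrow> 'a"
  assumes ip_add_right: "x \<in> M \<Longrightarrow> y \<in> M \<Longrightarrow> z \<in> M \<Longrightarrow> ip x (y + z) = ip x y + ip x z"
    and ip_scaleC_right: "x \<in> M \<Longrightarrow> y \<in> M \<Longrightarrow> ip x (c *\<^sub>C y) = c *\<^sub>C ip x y"
    and ip_act_right: "x \<in> M \<Longrightarrow> y \<in> M \<Longrightarrow> ip x (act y a) = ip x y * a"
    and ip_star: "x \<in> M \<Longrightarrow> y \<in> M \<Longrightarrow> ip x y = star (ip y x)"
    and ip_positive: "x \<in> M \<Longrightarrow> positive_elem (ip x x)"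
    and ip_definite: "x \<in> M \<Longrightarrow> ip x x = 0 \<Longrightarrow> x = 0"
    and complete: "Metric_space.mcomplete M (hilbert_dist M ip)"

text \<open>
  Maps on \<open>M\<close> are functions on the ambient type considered only up to their values on \<open>M\<close>;
  accordingly all equations between operators below are required pointwise on \<open>M\<close>.
\<close>

definition is_adjoint ::
    "'m set \<Rightarrow> ('m \<Rightarrow> 'm \<Rightarrow> 'a) \<Rightarrow> ('m \<Rightarrow> 'm) \<Rightarrow> ('m \<Rightarrow> 'm) \<Rightarrow> bool"
  where "is_adjoint M ip T S \<longleftrightarrow>
    T \<in> M \<rightarrow> M \<and> S \<in> M \<rightarrow> M \<and> (\<forall>x\<in>M. \<forall>y\<in>M. ip (T x) y = ip x (S y))"

definition adjointable_maps :: "'m set \<Rightarrow> ('m \<Rightarrow> 'm \<Rightarrow> 'a) \<Rightarrow> ('m \<Rightarrow> 'm) set"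
  where "adjointable_maps M ip = {T. \<exists>S. is_adjoint M ip T S}"

definition unital_star_hom ::
    "'m::complex_vector set \<Rightarrow> ('m \<Rightarrow> 'm \<Rightarrow> 'a) \<Rightarrow> ('b::unital_cstar_algebra \<Rightarrow> 'm \<Rightarrow> 'm) \<Rightarrow> bool"
  where "unital_star_hom M ip \<pi> \<longleftrightarrow>
    (\<forall>b. \<pi> b \<in> adjointable_maps M ip) \<and>
    (\<forall>b b'. \<forall>x\<in>M. \<pi> (b + b') x = \<pi> b x + \<pi> b' x) \<and>
    (\<forall>c b. \<forall>x\<in>M. \<pi> (c *\<^sub>C b) x = c *\<^sub>C \<pi> b x) \<and>
    (\<forall>b b'. \<forall>x\<in>M. \<pi> (b * b') x = \<pi> b (\<pi> b' x)) \<and>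
    (\<forall>x\<in>M. \<pi> 1 x = x) \<and>
    (\<forall>b. is_adjoint M ip (\<pi> b) (\<pi> (star b)))"

definition unitary_map ::
    "'m::complex_vector set \<Rightarrow> ('m \<Rightarrow> 'a::cstar_algebra \<Rightarrow> 'm) \<Rightarrow> ('m \<Rightarrow> 'm \<Rightarrow> 'a) \<Rightarrow>
     'n::complex_vector set \<Rightarrow> ('n \<Rightarrow> 'a \<Rightarrow> 'n) \<Rightarrow> ('n \<Rightarrow> 'n \<Rightarrow> 'a) \<Rightarrow> ('m \<Rightarrow> 'n) \<Rightarrow> bool"
  where "unitary_map M act ip M' act' ip' U \<longleftrightarrow>
    U \<in> Lin M act M' act' \<and> U ` M = M' \<and> (\<forall>x\<in>M. \<forall>y\<in>M. ip' (U x) (U y) = ip x y)"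

text \<open>The map \<open>J\<^sup>\<times>\<close>.\<close>

definition cross :: "('m \<Rightarrow> 'm \<Rightarrow> 'a) \<Rightarrow> ('v \<Rightarrow> 'm) \<Rightarrow> 'm \<Rightarrow> 'v \<Rightarrow> 'a"
  where "cross ip J m = (\<lambda>v. ip (J v) m)"

lemma (in hilbert_module) cross_in_antidual:
  assumes J: "J \<in> Lin UNIV actV M act" and m: "m \<in> M"
  shows "cross ip J m \<in> antidual actV"
proof -
  have JM: "J v \<in> M" for v
    using J by (auto simp: Lin_def)
  have Jadd: "J (v + w) = J v + J w" and Jsc: "J (c *\<^sub>C v) = c *\<^sub>C J v"
    and Jact: "J (actV v a) = act (J v) a" for v w c a
    using J by (simp_all add: Lin_def)
  have flip: "ip x m = star (ip m x)" if "x \<in> M" for x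
    using ip_star[OF that m] .
  have sub: "c *\<^sub>C J v \<in> M" "J v + J w \<in> M" for c v w
    using subspace JM by (simp_all add: complex_vector.subspace_scale complex_vector.subspace_add)
  show ?thesis
    unfolding antidual_def cross_def mem_Collect_eq Jadd Jsc Jact
    by (simp add: flip sub JM act_closed ip_add_right ip_scaleC_right ip_act_right m
        star_add star_scaleC star_mult)
qed


section \<open>Minimal dilations\<close>

text \<open>
  Any minimal dilation \<open>M\<close> embeds linearly into the function space \<open>'b \<Rightarrow> 'v \<Rightarrow> 'a\<close> by
  \<open>m \<mapsto> (\<lambda>b v. \<langle>\<pi>(b) J v | m\<rangle>)\<close>, injectively because the span of the vectors \<open>\<pi>(b) J v\<close> is dense.
  An existence statement, which in HOL has to name the type of the witness, therefore loses no
  generality by taking \<open>M\<close> to be a subspace of that type.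
\<close>

definition minimal_dilation ::
    "('v::complex_vector \<Rightarrow> 'a::cstar_algebra \<Rightarrow> 'v) \<Rightarrow>
     ('b::unital_cstar_algebra \<Rightarrow> 'v \<Rightarrow> 'v \<Rightarrow> 'a) \<Rightarrow>
     'm::complex_vector set \<Rightarrow> ('m \<Rightarrow> 'a \<Rightarrow> 'm) \<Rightarrow> ('m \<Rightarrow> 'm \<Rightarrow> 'a) \<Rightarrow>
     ('b \<Rightarrow> 'm \<Rightarrow> 'm) \<Rightarrow> ('v \<Rightarrow> 'm) \<Rightarrow> bool"
  where "minimal_dilation actV E M act ip \<pi> J \<longleftrightarrow>
    hilbert_module M act ip \<and>
    unital_star_hom M ip \<pi> \<and>
    J \<in> Lin UNIV actV M act \<and>
    (\<forall>b v v'. E b v v' = pairing v (cross ip J (\<pi> b (J v'))) \<and>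
       pairing v (cross ip J (\<pi> b (J v'))) = ip (J v) (\<pi> b (J v'))) \<and>
    Metric_space.mtopology M (hilbert_dist M ip)
      closure_of complex_vector.span {\<pi> b (J v) | b v. True} = M"

end

theory Submission
  imports Defs "HOL-Computational_Algebra.Formal_Power_Series"
begin

text \<open>
  The completely positive map gives a positive definite kernel on \<open>B \<times> V\<close>, namely
  \<open>k((b, v), (c, w)) = E(b\<^sup>* c)(v, w)\<close>, and the minimal dilation is its reproducing kernel module.
  In any dilation a vector \<open>m\<close> determines the function \<open>\<phi>\<^sub>m(b, v) = \<langle>\<pi>(b) J v|m\<rangle>\<close>. Under this
  correspondence \<open>\<pi>(c)\<close> becomes the shift \<open>\<phi> \<mapsto> \<phi>(c\<^sup>* \<cdot>, \<cdot>)\<close>, the action of \<open>A\<close> becomes right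
  multiplication, and \<open>\<pi>(b) J v\<close> becomes the kernel function of \<open>(b, v)\<close>. None of this refers to the
  given dilation, so existence and uniqueness are both settled by the function space: the
  functions approximated by sums of kernel functions form a minimal dilation
  (\<open>rk_minimal_dilation\<close>), and in every minimal dilation \<open>m \<mapsto> \<phi>\<^sub>m\<close> is a bijection onto that space
  which preserves the inner product (\<open>rk_ip_coord\<close>, \<open>bij_coord\<close>). A unitary between two minimal
  dilations is then one such bijection followed by the inverse of the other.

  The space is normed as a space of functionals on finite families of pairs \<open>(b, v)\<close>, themselves
  seminormed by their Gram sums \<open>\<Sum> E(b\<^sub>i\<^sup>* b\<^sub>j)(v\<^sub>i, v\<^sub>j)\<close>. Three facts about C*-algebras make this
  work. Complete positivity writes a Gram sum as a sum of elements \<open>y\<^sup>* y\<close>, so such sums have to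
  be of the form \<open>y\<^sup>* y\<close> again, and so do their limits. The Cauchy-Schwarz inequality
  (\<open>cstar_Cauchy_Schwarz\<close>) needs the order of \<open>A\<close>. Finally the shift by \<open>c\<close> is bounded by \<open>\<parallel>c\<parallel>\<close>
  (\<open>list_norm_mult_le\<close>), because \<open>\<parallel>c\<parallel>\<^sup>2 - c\<^sup>* c\<close> has a square root in \<open>B\<close>.

  The first parts therefore develop the order of a C*-algebra, without spectral theory. In a unital
  algebra a selfadjoint \<open>a\<close> counts as positive if \<open>\<parallel>t - a\<parallel> \<le> t\<close> for some \<open>t \<ge> 0\<close>. This is
  stable under sums at once, and the binomial series gives square roots (\<open>cstar_nonneg_sqrt\<close>);
  norm estimates for two commuting squares give closedness and monotonicity of the norm. The
  theorem that \<open>x\<^sup>* x\<close> is positive in this sense (\<open>cstar_nonneg_star_mult_self\<close>) identifies the two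
  notions of positivity. The unitization carries all of this over to algebras without identity.
\<close>


section \<open>Elementary facts about C*-algebras\<close>

lemma norm_star [simp]: "norm (star x) = norm (x::'a::cstar_algebra)"
proof -
  have le: "norm y \<le> norm (star y)" for y :: 'a
  proof (cases "y = 0")
    case False
    have "norm y * norm y \<le> norm (star y) * norm y"
      using norm_mult_ineq[of "star y" y] by (simp add: cstar_identity power2_eq_square)
    with False show ?thesis by simp
  qed simp
  show ?thesis using le[of x] le[of "star x"] by (simp add: star_star)
qed

lemma star_zero [simp]: "star (0::'a::cstar_algebra) = 0"
  using norm_star[of "0::'a"] by (simp del: norm_star)

lemma star_minus: "star (- x) = - star (x::'a::cstar_algebra)"
  using star_add[of x "- x"] by (simp add: eq_neg_iff_add_eq_0 add.commute)

lemma star_diff: "star (x - y) = star x - star (y::'a::cstar_algebra)"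
  using star_add[of x "- y"] by (simp add: star_minus)

lemma star_scaleR: "star (r *\<^sub>R x) = r *\<^sub>R star (x::'a::cstar_algebra)"
  by (simp add: scaleR_eq_scaleC star_scaleC)

lemma star_sum: "star (sum f S) = (\<Sum>i\<in>S. star (f i :: 'a::cstar_algebra))"
  by (induction S rule: infinite_finite_induct) (simp_all add: star_add)

lemma bounded_linear_star: "bounded_linear (star :: 'a::cstar_algebra \<Rightarrow> 'a)"
  by (rule bounded_linear_intro[where K = 1]) (simp_all add: star_add star_scaleR)

lemma star_mult_self_eq_0_iff: "star x * x = 0 \<longleftrightarrow> x = (0::'a::cstar_algebra)"
  using cstar_identity[of x] by auto

lemma norm_square_selfadjoint: "star h = h \<Longrightarrow> norm (h * h) = (norm (h::'a::cstar_algebra))\<^sup>2"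
  using cstar_identity[of h] by simp

lemma star_one [simp]: "star (1::'a::unital_cstar_algebra) = 1"
  by (metis mult_1 star_mult star_star)

lemma norm_le_one_unit: "norm (1::'a::unital_cstar_algebra) \<le> 1"
proof (cases "norm (1::'a) = 0")
  case False
  then show ?thesis using cstar_identity[of "1::'a"] by (simp add: power2_eq_square)
qed simp

lemma star_power: "star (x ^ n) = star x ^ n" for x :: "'a::unital_cstar_algebra"
  by (induction n) (simp_all add: star_mult power_commutes)

lemma norm_power_le: "norm (x ^ n) \<le> norm x ^ n" for x :: "'a::unital_cstar_algebra"
proof (induction n)
  case 0 show ?case by (simp add: norm_le_one_unit)
next
  case (Suc n)
  have "norm (x ^ Suc n) \<le> norm x * norm (x ^ n)" by (simp add: norm_mult_ineq)
  also have "\<dots> \<le> norm x * norm x ^ n" by (intro mult_left_mono Suc) simp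
  finally show ?case by simp
qed

text \<open>
  This takes the place of the spectral radius formula: bounds \<open>p k * N ^ k\<close> on the powers of a
  selfadjoint element, where \<open>p\<close> is polynomial, force its norm to be at most \<open>N\<close>.
\<close>

lemma norm_power_two_power:
  fixes s :: "'a::unital_cstar_algebra"
  assumes "star s = s"
  shows "norm (s ^ (2 ^ m)) = norm s ^ (2 ^ m)"
proof (induction m)
  case (Suc m)
  have "s ^ (2 ^ Suc m) = s ^ (2 ^ m) * s ^ (2 ^ m)"
    by (simp add: mult_2 power_add)
  then have "norm (s ^ (2 ^ Suc m)) = (norm (s ^ (2 ^ m)))\<^sup>2"
    using assms by (simp add: norm_square_selfadjoint star_power)
  also have "\<dots> = norm s ^ (2 ^ Suc m)"
    by (simp add: Suc power_mult[symmetric] mult.commute)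
  finally show ?case .
qed simp

text \<open>
  The germ of the monotonicity of the norm: the real part of \<open>y = c + \<i> d\<close> has norm at most \<open>\<parallel>y\<parallel>\<close>,
  and \<open>\<parallel>y\<parallel>\<^sup>2 = \<parallel>c\<^sup>2 + d\<^sup>2\<parallel>\<close> when \<open>c\<close> and \<open>d\<close> commute.
\<close>

lemma norm_square_le_sum_of_squares:
  fixes c d :: "'a::cstar_algebra"
  assumes c: "star c = c" and d: "star d = d" and cd: "c * d = d * c"
  shows "norm (c * c) \<le> norm (c * c + d * d)"
proof -
  define y where "y = c + \<i> *\<^sub>C d"
  have sy: "star y = c + (- \<i>) *\<^sub>C d"
    by (simp add: y_def star_add star_scaleC c d)
  have two: "y + star y = 2 *\<^sub>R c"
    unfolding sy unfolding y_def by (simp add: scaleR_2 algebra_simps flip: scaleC_add_left)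
  have "2 * norm c \<le> norm y + norm (star y)"
    using norm_triangle_ineq[of y "star y"] by (simp add: two)
  then have "norm c \<le> norm y" by simp
  moreover have "star y * y = c * c + d * d"
    unfolding sy unfolding y_def
    by (simp add: distrib_left distrib_right mult_scaleC_left mult_scaleC_right scaleC_scaleC cd
          algebra_simps scaleC_one flip: scaleC_add_left)
  ultimately show ?thesis
    using cstar_identity[of y] norm_square_selfadjoint[OF c] by (simp add: power_mono)
qed


section \<open>Square roots\<close>

text \<open>The Taylor coefficients of \<open>sqrt (1 - x)\<close>.\<close>

definition sqrt_coeff :: "nat \<Rightarrow> real"
  where "sqrt_coeff k = (1/2 gchoose k) * (- 1) ^ k"

lemma sqrt_coeff_0 [simp]: "sqrt_coeff 0 = 1"
  by (simp add: sqrt_coeff_def)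

lemma sqrt_coeff_convolution:
  "(\<Sum>i\<le>n. sqrt_coeff i * sqrt_coeff (n - i)) = (if n = 0 then 1 else if n = 1 then - 1 else 0)"
proof -
  have "(\<Sum>i\<le>n. sqrt_coeff i * sqrt_coeff (n - i))
      = (\<Sum>i\<le>n. ((1/2 gchoose i) * (1/2 gchoose (n - i))) * (- 1) ^ n)"
  proof (rule sum.cong)
    fix i assume "i \<in> {..n}"
    then have "(- 1 :: real) ^ n = (- 1) ^ i * (- 1) ^ (n - i)"
      by (simp flip: power_add)
    then show "sqrt_coeff i * sqrt_coeff (n - i)
        = ((1/2 gchoose i) * (1/2 gchoose (n - i))) * (- 1) ^ n"
      by (simp add: sqrt_coeff_def)
  qed simp
  also have "\<dots> = (1 gchoose n) * (- 1 :: real) ^ n"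
    using gbinomial_Vandermonde[of "1/2 :: real" "1/2" n]
    by (simp add: atMost_atLeast0 flip: sum_distrib_right)
  also have "(1 gchoose n :: real) = of_nat (1 choose n)"
    using binomial_gbinomial[of 1 n, where 'a = real] by simp
  finally show ?thesis
    by (cases "n \<le> 1") (auto simp: le_Suc_eq binomial_eq_0)
qed

text \<open>
  All coefficients but the first are negative, and the partial sums, which are the coefficients of
  \<open>(1 - x) powr (- 1/2)\<close>, are nonnegative. So the series converges absolutely on the whole closed
  unit ball.
\<close>

lemma sum_abs_sqrt_coeff_le: "(\<Sum>k<n. \<bar>sqrt_coeff (Suc k)\<bar>) \<le> 1"
proof -
  define d :: "nat \<Rightarrow> real" where "d n = (- 1) ^ n * (- 1/2 gchoose n)" for n
  have partial: "(\<Sum>k\<le>n. sqrt_coeff k) = d n" for n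
    using gbinomial_sum_lower_neg[of "1/2 :: real" n] by (simp add: sqrt_coeff_def d_def)
  have rec: "d (Suc n) = d n * ((real n + 1/2) / (real n + 1))" for n
    by (simp add: d_def gbinomial_prod_rev field_simps)
  have nonneg: "0 \<le> d n" for n
    by (induction n) (simp_all add: rec, simp add: d_def)
  have "d (Suc n) \<le> d n" for n
    unfolding rec using nonneg[of n] by (intro mult_left_le) auto
  moreover have "sqrt_coeff (Suc n) = d (Suc n) - d n" for n
    by (simp flip: partial)
  ultimately have "\<bar>sqrt_coeff (Suc n)\<bar> = d n - d (Suc n)" for n
    by (metis abs_of_nonpos diff_le_0_iff_le minus_diff_eq)
  then have "(\<Sum>k<n. \<bar>sqrt_coeff (Suc k)\<bar>) = d 0 - d n"
    by (simp add: sum_lessThan_telescope')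
  then show ?thesis using nonneg[of n] by (simp add: d_def)
qed

lemma summable_abs_sqrt_coeff: "summable (\<lambda>k. \<bar>sqrt_coeff k\<bar>)"
proof -
  have "summable (\<lambda>k. \<bar>sqrt_coeff (Suc k)\<bar>)"
    by (rule summableI_nonneg_bounded[OF _ sum_abs_sqrt_coeff_le]) simp
  then show ?thesis by (subst (asm) summable_Suc_iff)
qed

definition sqrt_one_minus :: "'a::unital_cstar_algebra \<Rightarrow> 'a"
  where "sqrt_one_minus x = (\<Sum>k. sqrt_coeff k *\<^sub>R x ^ k)"

context
  fixes x :: "'a::unital_cstar_algebra"
  assumes x: "norm x \<le> 1"
begin

lemma norm_sqrt_term_le: "norm (sqrt_coeff k *\<^sub>R x ^ k) \<le> \<bar>sqrt_coeff k\<bar>"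
proof -
  have "norm (x ^ k) \<le> 1"
    using norm_power_le[of x k] power_le_one[OF norm_ge_zero x, of k] by linarith
  then show ?thesis by (simp add: mult_left_le)
qed

lemma summable_norm_sqrt_term: "summable (\<lambda>k. norm (sqrt_coeff k *\<^sub>R x ^ k))"
  by (rule summable_comparison_test'[OF summable_abs_sqrt_coeff, where N = 0])
    (use norm_sqrt_term_le in simp)

lemma sqrt_one_minus_square: "sqrt_one_minus x * sqrt_one_minus x = 1 - x"
proof -
  have "sqrt_one_minus x * sqrt_one_minus x
      = (\<Sum>n. \<Sum>i\<le>n. sqrt_coeff i *\<^sub>R x ^ i * sqrt_coeff (n - i) *\<^sub>R x ^ (n - i))"
    unfolding sqrt_one_minus_def
    by (rule Cauchy_product) (rule summable_norm_sqrt_term)+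
  also have "\<dots> = (\<Sum>n. (\<Sum>i\<le>n. sqrt_coeff i * sqrt_coeff (n - i)) *\<^sub>R x ^ n)"
  proof (rule suminf_cong)
    fix n
    have "sqrt_coeff i *\<^sub>R x ^ i * sqrt_coeff (n - i) *\<^sub>R x ^ (n - i)
        = (sqrt_coeff i * sqrt_coeff (n - i)) *\<^sub>R x ^ n" if "i \<le> n" for i
      using that by (simp add: mult.commute flip: power_add)
    then show "(\<Sum>i\<le>n. sqrt_coeff i *\<^sub>R x ^ i * sqrt_coeff (n - i) *\<^sub>R x ^ (n - i))
        = (\<Sum>i\<le>n. sqrt_coeff i * sqrt_coeff (n - i)) *\<^sub>R x ^ n"
      by (simp add: scaleR_sum_left)
  qed
  also have "\<dots> = (\<Sum>n\<in>{0,1}. (\<Sum>i\<le>n. sqrt_coeff i * sqrt_coeff (n - i)) *\<^sub>R x ^ n)"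
    by (rule suminf_finite) (auto simp: sqrt_coeff_convolution)
  also have "\<dots> = 1 - x"
    unfolding sqrt_coeff_convolution by simp
  finally show ?thesis .
qed

lemma sqrt_one_minus_commute:
  assumes "z * x = x * z"
  shows "z * sqrt_one_minus x = sqrt_one_minus x * z"
proof -
  have "z * x ^ k = x ^ k * z" for k
    using assms by (induction k) (simp_all, metis mult.assoc)
  then show ?thesis
    unfolding sqrt_one_minus_def
    using summable_norm_cancel[OF summable_norm_sqrt_term]
    by (simp add: suminf_mult2 flip: suminf_mult)
qed

lemma star_sqrt_one_minus: "star x = x \<Longrightarrow> star (sqrt_one_minus x) = sqrt_one_minus x"
  unfolding sqrt_one_minus_def
  by (subst bounded_linear.suminf[OF bounded_linear_star summable_norm_cancel[OF summable_norm_sqrt_term]])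
    (simp add: star_scaleR star_power)

lemma norm_one_minus_sqrt_one_minus: "norm (1 - sqrt_one_minus x) \<le> 1"
proof -
  let ?t = "\<lambda>k. sqrt_coeff (Suc k) *\<^sub>R x ^ Suc k"
  have sn: "summable (\<lambda>k. norm (?t k))"
    using summable_norm_sqrt_term by (subst summable_Suc_iff)
  have "sqrt_one_minus x = 1 + (\<Sum>k. ?t k)"
    unfolding sqrt_one_minus_def
    using suminf_split_head[OF summable_norm_cancel[OF summable_norm_sqrt_term]] by simp
  then have "norm (1 - sqrt_one_minus x) = norm (\<Sum>k. ?t k)" by simp
  also have "\<dots> \<le> (\<Sum>k. norm (?t k))" by (rule summable_norm[OF sn])
  also have "\<dots> \<le> 1"
  proof (rule suminf_le_const[OF sn])
    fix n
    have "(\<Sum>k<n. norm (?t k)) \<le> (\<Sum>k<n. \<bar>sqrt_coeff (Suc k)\<bar>)"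
      by (rule sum_mono) (rule norm_sqrt_term_le)
    also have "\<dots> \<le> 1" by (rule sum_abs_sqrt_coeff_le)
    finally show "(\<Sum>k<n. norm (?t k)) \<le> 1" .
  qed
  finally show ?thesis .
qed

end


section \<open>Positivity in a unital C*-algebra\<close>

text \<open>
  For a selfadjoint element the norm condition says that the spectrum lies in \<open>[0, 2 t]\<close>. In this form positivity is visibly stable under sums, and it is the condition
  under which the series of \<open>sqrt_one_minus\<close> produces a square root.
\<close>

definition cstar_nonneg :: "'a::unital_cstar_algebra \<Rightarrow> bool"
  where "cstar_nonneg a \<longleftrightarrow> star a = a \<and> (\<exists>t\<ge>0. norm (t *\<^sub>R 1 - a) \<le> t)"

lemma cstar_nonnegI: "star a = a \<Longrightarrow> norm (t *\<^sub>R 1 - a) \<le> t \<Longrightarrow> cstar_nonneg a"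
  unfolding cstar_nonneg_def using norm_ge_zero order_trans by blast

lemma cstar_nonneg_selfadjoint: "cstar_nonneg a \<Longrightarrow> star a = a"
  by (simp add: cstar_nonneg_def)

lemma cstar_nonneg_add: "cstar_nonneg a \<Longrightarrow> cstar_nonneg b \<Longrightarrow> cstar_nonneg (a + b)"
proof -
  assume "cstar_nonneg a" "cstar_nonneg b"
  then obtain s t where st: "star a = a" "star b = b"
      "norm (s *\<^sub>R 1 - a) \<le> s" "norm (t *\<^sub>R 1 - b) \<le> t"
    by (auto simp: cstar_nonneg_def)
  have "norm ((s + t) *\<^sub>R 1 - (a + b)) \<le> norm (s *\<^sub>R 1 - a) + norm (t *\<^sub>R 1 - b)"
    by (rule order_trans[OF _ norm_triangle_ineq]) (simp add: algebra_simps)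
  with st show ?thesis
    by (intro cstar_nonnegI[of _ "s + t"]) (auto simp: star_add)
qed

lemma cstar_nonneg_scaleR: "0 \<le> r \<Longrightarrow> cstar_nonneg a \<Longrightarrow> cstar_nonneg (r *\<^sub>R a)"
proof -
  assume r: "0 \<le> r" and "cstar_nonneg a"
  then obtain t where t: "star a = a" "norm (t *\<^sub>R 1 - a) \<le> t"
    by (auto simp: cstar_nonneg_def)
  have "norm ((r * t) *\<^sub>R 1 - r *\<^sub>R a) = r * norm (t *\<^sub>R 1 - a)"
    using r by (metis abs_of_nonneg norm_scaleR scaleR_right_diff_distrib scaleR_scaleR)
  with r t show ?thesis
    by (intro cstar_nonnegI[of _ "r * t"]) (auto simp: star_scaleR mult_left_mono)
qed

lemma cstar_nonneg_sqrt:
  assumes "cstar_nonneg a"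
  obtains h where "cstar_nonneg h" "h * h = a" "\<And>z. z * a = a * z \<Longrightarrow> z * h = h * z"
proof -
  obtain t where t: "0 \<le> t" "norm (t *\<^sub>R 1 - a) \<le> t" and sa: "star a = a"
    using assms by (auto simp: cstar_nonneg_def)
  show thesis
  proof (cases "t = 0")
    case True
    then show thesis using t by (intro that[of 0]) (auto intro: cstar_nonnegI[of _ 0])
  next
    case False
    define x where "x = 1 - (1 / t) *\<^sub>R a"
    have tx: "t *\<^sub>R x = t *\<^sub>R 1 - a"
      using False by (simp add: x_def scaleR_right_diff_distrib)
    have "t * norm x \<le> t"
      using t tx by (metis abs_of_nonneg norm_scaleR)
    with False t have x: "norm x \<le> 1" by simp
    have sx: "star x = x"
      by (simp add: x_def star_diff star_scaleR sa)
    define h where "h = sqrt t *\<^sub>R sqrt_one_minus x"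
    show thesis
    proof (rule that)
      have "sqrt t *\<^sub>R 1 - h = sqrt t *\<^sub>R (1 - sqrt_one_minus x)"
        by (simp add: h_def scaleR_right_diff_distrib)
      then have "norm (sqrt t *\<^sub>R 1 - h) \<le> sqrt t"
        using norm_one_minus_sqrt_one_minus[OF x] t(1) by (simp add: mult_left_le)
      then show "cstar_nonneg h"
        by (intro cstar_nonnegI) (simp_all add: h_def star_scaleR star_sqrt_one_minus[OF x sx])
      have "h * h = t *\<^sub>R (1 - x)"
        using t(1) by (simp add: h_def sqrt_one_minus_square[OF x])
      then show "h * h = a"
        using False by (simp add: x_def)
      show "z * h = h * z" if "z * a = a * z" for z
      proof -
        have "z * x = x * z" using that by (simp add: x_def algebra_simps)
        from sqrt_one_minus_commute[OF x this] show ?thesis by (simp add: h_def)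
      qed
    qed
  qed
qed

lemma norm_scaleR_one_le: "0 \<le> t \<Longrightarrow> norm (t *\<^sub>R (1::'a::unital_cstar_algebra)) \<le> t"
  using norm_le_one_unit[where 'a = 'a] by (simp add: mult_left_le)

text \<open>
  With \<open>c\<close> the square root of \<open>t - h\<^sup>2\<close>, which commutes with \<open>h\<close>, the bound follows from
  \<open>c\<^sup>2 + h\<^sup>2 = t\<close>.
\<close>

lemma norm_scaleR_one_minus_square_le:
  fixes h :: "'a::unital_cstar_algebra"
  assumes h: "star h = h" and t: "(norm h)\<^sup>2 \<le> t"
  shows "norm (t *\<^sub>R 1 - h * h) \<le> t"
proof -
  have "norm (h * h) \<le> t"
    using t by (simp add: norm_square_selfadjoint h)
  then have "cstar_nonneg (t *\<^sub>R 1 - h * h)"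
    by (intro cstar_nonnegI[of _ t]) (simp_all add: star_diff star_scaleR star_mult h)
  then obtain c where c: "cstar_nonneg c" "c * c = t *\<^sub>R 1 - h * h"
    and comm: "\<And>z. z * (t *\<^sub>R 1 - h * h) = (t *\<^sub>R 1 - h * h) * z \<Longrightarrow> z * c = c * z"
    by (metis cstar_nonneg_sqrt)
  have "h * c = c * h" by (rule comm) (simp add: algebra_simps)
  then have "norm (c * c) \<le> norm (c * c + h * h)"
    using c(1) h by (intro norm_square_le_sum_of_squares) (simp_all add: cstar_nonneg_selfadjoint)
  also have "c * c + h * h = t *\<^sub>R 1" using c(2) by simp
  also have "norm (t *\<^sub>R (1::'a)) \<le> t"
    using t by (intro norm_scaleR_one_le) (meson order_trans zero_le_power2)
  finally show ?thesis by (simp add: c(2))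
qed

lemma cstar_nonneg_square: "star h = h \<Longrightarrow> cstar_nonneg (h * h)"
  by (rule cstar_nonnegI[OF _ norm_scaleR_one_minus_square_le[OF _ order_refl]])
    (simp_all add: star_mult)

lemma cstar_nonneg_norm_bound:
  assumes "cstar_nonneg a" "norm a \<le> t"
  shows "norm (t *\<^sub>R 1 - a) \<le> t"
proof -
  obtain h where h: "cstar_nonneg h" "h * h = a"
    using assms(1) cstar_nonneg_sqrt by metis
  have "(norm h)\<^sup>2 \<le> t"
    using norm_square_selfadjoint[OF cstar_nonneg_selfadjoint[OF h(1)]] h(2) assms(2) by simp
  from norm_scaleR_one_minus_square_le[OF cstar_nonneg_selfadjoint[OF h(1)] this] show ?thesis
    by (simp add: h(2))
qed

lemma cstar_nonneg_scaleR_one_minus: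
  fixes b :: "'a::unital_cstar_algebra"
  assumes "star b = b" "norm b \<le> t"
  shows "cstar_nonneg (t *\<^sub>R 1 - b)"
  using assms by (intro cstar_nonnegI[of _ t]) (simp_all add: star_diff star_scaleR)

text \<open>The choice \<open>t = \<parallel>a\<parallel>\<close> makes the condition continuous in \<open>a\<close>.\<close>

lemma cstar_nonneg_limit:
  fixes f :: "nat \<Rightarrow> 'a::unital_cstar_algebra"
  assumes f: "f \<longlonglongrightarrow> a" and nn: "\<And>n. cstar_nonneg (f n)"
  shows "cstar_nonneg a"
proof (rule cstar_nonnegI)
  have "(\<lambda>n. star (f n)) \<longlonglongrightarrow> star a"
    by (rule bounded_linear.tendsto[OF bounded_linear_star f])
  with f show "star a = a"
    using LIMSEQ_unique by (simp add: cstar_nonneg_selfadjoint[OF nn])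
  show "norm (norm a *\<^sub>R 1 - a) \<le> norm a"
    by (rule LIMSEQ_le[where X = "\<lambda>n. norm (norm (f n) *\<^sub>R 1 - f n)" and Y = "\<lambda>n. norm (f n)"])
      (auto intro!: tendsto_intros f cstar_nonneg_norm_bound nn)
qed

text \<open>
  With \<open>N = \<parallel>b\<parallel>\<close>, both \<open>a\<close> and \<open>N - a\<close> are squares of commuting selfadjoint elements.
\<close>

lemma cstar_nonneg_norm_mono:
  fixes a b :: "'a::unital_cstar_algebra"
  assumes a: "cstar_nonneg a" and ba: "cstar_nonneg (b - a)"
  shows "norm a \<le> norm b"
proof -
  have "star b = b"
    using cstar_nonneg_selfadjoint[OF cstar_nonneg_add[OF a ba]] by simp
  then have "cstar_nonneg ((norm b *\<^sub>R 1 - b) + (b - a))"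
    by (intro cstar_nonneg_add ba cstar_nonneg_scaleR_one_minus) simp_all
  then have c: "cstar_nonneg (norm b *\<^sub>R 1 - a)" by simp
  obtain h where h: "cstar_nonneg h" "h * h = a"
    using a cstar_nonneg_sqrt by metis
  obtain k where k: "cstar_nonneg k" "k * k = norm b *\<^sub>R 1 - a"
    and comm: "\<And>z. z * (norm b *\<^sub>R 1 - a) = (norm b *\<^sub>R 1 - a) * z \<Longrightarrow> z * k = k * z"
    using c cstar_nonneg_sqrt by metis
  have "h * k = k * h" by (rule comm) (simp add: algebra_simps flip: h(2))
  then have "norm (h * h) \<le> norm (h * h + k * k)"
    using h(1) k(1) by (intro norm_square_le_sum_of_squares) (simp_all add: cstar_nonneg_selfadjoint)
  also have "h * h + k * k = norm b *\<^sub>R 1" by (simp add: h k)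
  also have "norm (norm b *\<^sub>R (1::'a)) \<le> norm b" by (rule norm_scaleR_one_le) simp
  finally show ?thesis by (simp add: h(2))
qed

lemma power_le_linear_imp_le_one:
  fixes r :: real
  assumes r: "0 \<le> r" and bound: "\<And>m. r ^ (2 ^ m) \<le> 1 + 2 ^ m"
  shows "r \<le> 1"
proof (rule ccontr)
  assume "\<not> r \<le> 1"
  then have "(\<lambda>n. real n / r ^ n) \<longlonglongrightarrow> 0"
    using lim_n_over_pown[of r] by simp
  moreover have "(\<lambda>n. 1 / r ^ n) \<longlonglongrightarrow> 0"
    using \<open>\<not> r \<le> 1\<close> LIMSEQ_inverse_realpow_zero[of r] by (simp add: inverse_eq_divide)
  ultimately have "(\<lambda>n. 1 / r ^ n + real n / r ^ n) \<longlonglongrightarrow> 0"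
    using tendsto_add by fastforce
  then have "\<forall>\<^sub>F n in sequentially. 1 / r ^ n + real n / r ^ n < 1"
    by (rule order_tendstoD) simp
  then obtain N where N: "\<And>n. N \<le> n \<Longrightarrow> 1 / r ^ n + real n / r ^ n < 1"
    by (auto simp: eventually_sequentially)
  have "N \<le> 2 ^ N" by (rule less_imp_le[OF less_exp])
  from N[OF this] have "1 + 2 ^ N < r ^ (2 ^ N)"
    using \<open>\<not> r \<le> 1\<close> by (simp add: field_simps add_divide_distrib[symmetric])
  with bound[of N] show False by simp
qed

text \<open>
  If \<open>- y\<^sup>* y\<close> is positive then so is \<open>y y\<^sup>* = 2 (u\<^sup>2 + v\<^sup>2) - y\<^sup>* y\<close>, where \<open>u\<close> and \<open>v\<close> are the real and
  imaginary parts of \<open>y\<close>. Usually one now invokes that \<open>y y\<^sup>*\<close> and \<open>y\<^sup>* y\<close> have the same nonzero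
  spectrum. Here the powers of \<open>N - y\<^sup>* y\<close> are related to those of \<open>N - y y\<^sup>*\<close>, which have norm at
  most \<open>N ^ k\<close>: the former grow at most like \<open>(1 + k) N ^ k\<close>, which for a selfadjoint element bounds
  the norm by \<open>N\<close>. So \<open>y\<^sup>* y\<close> is positive along with \<open>- y\<^sup>* y\<close>, and vanishes.
\<close>

lemma negative_star_mult_self_imp_zero:
  fixes y :: "'a::unital_cstar_algebra"
  assumes neg: "cstar_nonneg (- (star y * y))"
  shows "y = 0"
proof (rule ccontr)
  assume "y \<noteq> 0"
  define N where "N = norm (y * star y)"
  have N: "N = (norm y)\<^sup>2" "0 < N"
    using cstar_identity[of "star y"] \<open>y \<noteq> 0\<close> by (simp_all add: N_def star_star)
  \<comment> \<open>Up to signs, twice the real and the imaginary part of \<open>y\<close>.\<close>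
  define u where "u = y + star y"
  define v where "v = \<i> *\<^sub>C (y - star y)"
  have "star u = u" by (simp add: u_def star_add star_star add.commute)
  moreover have "star v = v"
    by (simp add: v_def star_scaleC star_diff star_star complex_vector.scale_minus_left
          complex_vector.scale_right_diff_distrib)
  ultimately have "cstar_nonneg ((1/2) *\<^sub>R (u * u + v * v) + - (star y * y))"
    by (intro cstar_nonneg_add cstar_nonneg_scaleR cstar_nonneg_square neg) simp_all
  moreover have "u * u + v * v = 2 *\<^sub>R (y * star y + star y * y)"
    by (simp add: u_def v_def mult_scaleC_left mult_scaleC_right scaleC_scaleC algebra_simps scaleR_2
        complex_vector.scale_minus_left scaleC_one)
  ultimately have "cstar_nonneg (y * star y)" by simp
  then have q: "norm (N *\<^sub>R 1 - y * star y) \<le> N"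
    by (rule cstar_nonneg_norm_bound) (simp add: N_def)
  \<comment> \<open>\<open>g\<close> is the sum of \<open>N ^ (k - 1 - j) (N - y y\<^sup>*) ^ j\<close> over \<open>j < k\<close>.\<close>
  have powers: "\<exists>g. (N *\<^sub>R 1 - star y * y) ^ k = N ^ k *\<^sub>R 1 - star y * g * y
      \<and> N * norm g \<le> real k * N ^ k" for k
  proof (induction k)
    case 0
    show ?case by (rule exI[of _ 0]) simp
  next
    case (Suc k)
    then obtain g where g: "(N *\<^sub>R 1 - star y * y) ^ k = N ^ k *\<^sub>R 1 - star y * g * y"
        "N * norm g \<le> real k * N ^ k" by blast
    define g' where "g' = N ^ k *\<^sub>R 1 + (N *\<^sub>R 1 - y * star y) * g"
    have "(N *\<^sub>R 1 - star y * y) ^ Suc k = N ^ Suc k *\<^sub>R 1 - star y * g' * y"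
      by (simp add: g(1) g'_def algebra_simps)
    moreover have "N * norm g' \<le> real (Suc k) * N ^ Suc k"
    proof -
      have "norm g' \<le> N ^ k + N * norm g"
        using norm_triangle_ineq[of "N ^ k *\<^sub>R 1" "(N *\<^sub>R 1 - y * star y) * g"]
          norm_mult_ineq[of "N *\<^sub>R 1 - y * star y" g] mult_right_mono[OF q norm_ge_zero[of g]]
          norm_scaleR_one_le[OF zero_le_power[OF less_imp_le[OF N(2)]], where 'a = 'a, of k]
        unfolding g'_def by linarith
      with g(2) have "norm g' \<le> real (Suc k) * N ^ k" by (simp add: algebra_simps)
      from mult_left_mono[OF this less_imp_le[OF N(2)]] show ?thesis by (simp add: algebra_simps)
    qed
    ultimately show ?case by blast
  qed
  define s where "s = N *\<^sub>R 1 - star y * y"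
  have s: "star s = s" by (simp add: s_def star_diff star_scaleR star_mult star_star)
  have "norm (s ^ k) \<le> (1 + real k) * N ^ k" for k
  proof -
    obtain g where g: "s ^ k = N ^ k *\<^sub>R 1 - star y * g * y" "N * norm g \<le> real k * N ^ k"
      using powers s_def by blast
    have "norm (star y * g * y) \<le> norm y * norm g * norm y"
      using norm_mult_ineq[of "star y * g" y] norm_mult_ineq[of "star y" g]
      by (metis mult_right_mono norm_ge_zero norm_star order_trans)
    also have "\<dots> = N * norm g" by (simp add: N power2_eq_square)
    finally have "norm (s ^ k) \<le> N ^ k + real k * N ^ k"
      using norm_triangle_ineq4[of "N ^ k *\<^sub>R 1" "star y * g * y"]
        norm_scaleR_one_le[OF zero_le_power[OF less_imp_le[OF N(2)]], where 'a = 'a, of k] g(2)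
      unfolding g(1) by linarith
    then show ?thesis by (simp add: algebra_simps)
  qed
  then have "norm s ^ (2 ^ m) \<le> (1 + 2 ^ m) * N ^ (2 ^ m)" for m
    using norm_power_two_power[OF s, of m] by (metis of_nat_numeral of_nat_power)
  then have "(norm s / N) ^ (2 ^ m) \<le> 1 + 2 ^ m" for m
    using N(2) by (simp add: power_divide divide_le_eq)
  then have "norm s / N \<le> 1"
    using N(2) by (intro power_le_linear_imp_le_one) simp_all
  then have "norm s \<le> N" using N(2) by (simp add: divide_le_eq)
  then have "cstar_nonneg (star y * y)"
    by (intro cstar_nonnegI[of _ N]) (simp_all add: s_def star_mult star_star)
  then have "norm (star y * y) \<le> norm (0::'a)"
    using neg by (intro cstar_nonneg_norm_mono) simp_all
  with \<open>y \<noteq> 0\<close> show False by (simp add: star_mult_self_eq_0_iff)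
qed

text \<open>
  Let \<open>a = x\<^sup>* x\<close>, let \<open>m = \<bar>a\<bar>\<close> be the square root of \<open>a\<^sup>2\<close>, and let \<open>u = m - a\<close>, which is twice the negative
  part of \<open>a\<close>. Then \<open>a u = - m u\<close>, so that \<open>y = x u\<close> satisfies \<open>y\<^sup>* y = - m u\<^sup>2\<close>, a negative element.
  Hence \<open>y = 0\<close>, so that \<open>a u = 0\<close> and \<open>m u = 0\<close>; thus \<open>u\<^sup>2 = 0\<close> and \<open>a = m\<close>.
\<close>

theorem cstar_nonneg_star_mult_self: "cstar_nonneg (star x * x)"
proof -
  define a where "a = star x * x"
  have sa: "star a = a" by (simp add: a_def star_mult star_star)
  obtain m where m: "cstar_nonneg m" "m * m = a * a"
    and comm: "\<And>z. z * (a * a) = a * a * z \<Longrightarrow> z * m = m * z"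
    using cstar_nonneg_sqrt[OF cstar_nonneg_square[OF sa]] by metis
  have am: "a * m = m * a" by (rule comm) (simp add: mult.assoc)
  define u where "u = m - a"
  have su: "star u = u" using cstar_nonneg_selfadjoint[OF m(1)] by (simp add: u_def star_diff sa)
  have mu: "m * u = u * m" by (simp add: u_def algebra_simps am)
  have aum: "a * u = - (m * u)" by (simp add: u_def algebra_simps am m)
  obtain k where k: "cstar_nonneg k" "k * k = m" and kcomm: "\<And>z. z * m = m * z \<Longrightarrow> z * k = k * z"
    using cstar_nonneg_sqrt[OF m(1)] by metis
  have ku: "u * k = k * u" by (rule kcomm) (simp add: mu)
  have "star (x * u) * (x * u) = u * (a * u)"
    by (simp add: star_mult su a_def mult.assoc)
  also have "\<dots> = - (u * (k * k) * u)" by (simp add: aum k(2) mult.assoc)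
  also have "u * (k * k) * u = (k * u) * (k * u)" using ku by (metis mult.assoc)
  finally have y: "star (x * u) * (x * u) = - ((k * u) * (k * u))" .
  have "star (k * u) = k * u" by (simp add: star_mult su cstar_nonneg_selfadjoint[OF k(1)] ku)
  from cstar_nonneg_square[OF this] have "x * u = 0"
    by (intro negative_star_mult_self_imp_zero) (simp add: y)
  then have "a * u = 0" by (simp add: a_def mult.assoc)
  then have "u * u = 0" using aum by (simp add: u_def algebra_simps)
  then have "u = 0" using star_mult_self_eq_0_iff[of u] su by simp
  then show ?thesis using m(1) by (simp add: u_def a_def)
qed


section \<open>The unitization of a C*-algebra\<close>

datatype 'a unitization = Unitization (ubase: 'a) (uscal: complex)

definition uact :: "'a::cstar_algebra unitization \<Rightarrow> 'a \<Rightarrow> 'a"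
  where "uact x b = ubase x * b + uscal x *\<^sub>C b"

lemma unitization_eqI: "ubase x = ubase y \<Longrightarrow> uscal x = uscal y \<Longrightarrow> x = y"
  by (simp add: unitization.expand)

instantiation unitization :: (cstar_algebra) ab_group_add
begin
definition "0 = Unitization 0 0"
definition "x + y = Unitization (ubase x + ubase y) (uscal x + uscal y)"
definition "x - y = Unitization (ubase x - ubase y) (uscal x - uscal y)"
definition "- x = Unitization (- ubase x) (- uscal x)"
instance
  by standard (auto intro!: unitization_eqI
      simp: zero_unitization_def plus_unitization_def minus_unitization_def uminus_unitization_def)
end

instantiation unitization :: (cstar_algebra) complex_vector
begin
definition "c *\<^sub>C x = Unitization (c *\<^sub>C ubase x) (c * uscal x)"
instance
  by standard (auto intro!: unitization_eqI
      simp: plus_unitization_def scaleC_unitization_def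
      scaleC_add_left scaleC_add_right scaleC_scaleC scaleC_one algebra_simps)
end

text \<open>
  The norm of left multiplication on the original algebra satisfies the C*-identity; it need not
  separate points, if the algebra already has an identity. Taking the maximum with
  the norm of the scalar component repairs this and treats both cases alike.
\<close>

instantiation unitization :: (cstar_algebra) "{real_normed_vector, times, one}"
begin
definition "r *\<^sub>R x = Unitization (r *\<^sub>R ubase x) (r *\<^sub>R uscal x)"
definition "norm x = max (onorm (uact x)) (cmod (uscal x))"
definition "sgn x = (inverse (norm x)) *\<^sub>R (x :: 'a unitization)"
definition "dist x y = norm (x - y :: 'a unitization)"
definition "uniformity = (INF e\<in>{0<..}. principal {(x, y :: 'a unitization). dist x y < e})"
definition "open U = (\<forall>x\<in>U. \<forall>\<^sub>F (x', y) in uniformity. x' = x \<longrightarrow> (y :: 'a unitization) \<in> U)"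
definition "x * y = Unitization
  (ubase x * ubase y + uscal y *\<^sub>C ubase x + uscal x *\<^sub>C ubase y) (uscal x * uscal y)"
definition "1 = Unitization 0 1"

lemma bounded_linear_scaleC: "bounded_linear (\<lambda>b::'a. c *\<^sub>C b)"
  by (rule bounded_linear_intro[where K = "cmod c"])
    (simp_all add: scaleC_add_right scaleR_eq_scaleC scaleC_scaleC norm_scaleC mult.commute)

lemma bounded_linear_uact: "bounded_linear (uact (x :: 'a unitization))"
  unfolding uact_def
  by (intro bounded_linear_add bounded_linear_mult_right bounded_linear_scaleC)

lemma uact_simps [simp]:
  "uact 0 b = 0" "uact 1 b = b" "uact (x + y) b = uact x b + uact y b"
  "uact (x - y) b = uact x b - uact y b" "uact (r *\<^sub>R x) b = r *\<^sub>R uact x b"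
  "uact (c *\<^sub>C x) b = c *\<^sub>C uact x b" "uact (x * y) b = uact x (uact y (b :: 'a))"
  by (simp_all add: uact_def zero_unitization_def one_unitization_def plus_unitization_def
      minus_unitization_def scaleR_unitization_def scaleC_unitization_def times_unitization_def
      scaleC_add_left scaleC_add_right scaleC_scaleC scaleC_one mult_scaleC_left mult_scaleC_right
      scaleR_eq_scaleC scaleR_conv_of_real mult.assoc distrib_left distrib_right
      left_diff_distrib right_diff_distrib complex_vector.scale_left_diff_distrib)

lemma norm_uact_le: "norm (uact x b) \<le> norm x * norm (b :: 'a)"
proof -
  have "norm (uact x b) \<le> onorm (uact x) * norm b"
    by (rule onorm[OF bounded_linear_uact])
  also have "\<dots> \<le> norm x * norm b"
    by (rule mult_right_mono) (simp_all add: norm_unitization_def)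
  finally show ?thesis .
qed

lemma norm_uscal_le: "cmod (uscal x) \<le> norm (x :: 'a unitization)"
  by (simp add: norm_unitization_def)

lemma norm_unitization_leI:
  assumes "\<And>b. norm (uact x b) \<le> C * norm (b :: 'a)" "cmod (uscal x) \<le> C"
  shows "norm x \<le> C"
  using assms onorm_bound[of C "uact x"] order_trans[OF norm_ge_zero assms(2)]
  by (simp add: norm_unitization_def)

lemma norm_Unitization_le: "norm (Unitization (a :: 'a) c) \<le> norm a + cmod c"
proof (rule norm_unitization_leI)
  fix b :: 'a
  have "norm (uact (Unitization a c) b) \<le> norm (a * b) + cmod c * norm b"
    by (simp add: uact_def norm_scaleC[symmetric] norm_triangle_ineq)
  also have "\<dots> \<le> (norm a + cmod c) * norm b"
    by (simp add: norm_mult_ineq distrib_right)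
  finally show "norm (uact (Unitization a c) b) \<le> (norm a + cmod c) * norm b" .
qed simp

text \<open>
  Together with \<open>norm_uscal_le\<close> and \<open>norm_Unitization_le\<close> this makes the topology that of the
  product, whence completeness.
\<close>

lemma norm_ubase_le: "norm (ubase x) \<le> 2 * norm (x :: 'a unitization)"
proof (cases "ubase x = 0")
  case False
  have "norm (ubase x) * norm (ubase x) = norm (ubase x * star (ubase x))"
    using cstar_identity[of "star (ubase x)"] by (simp add: star_star power2_eq_square)
  also have "ubase x * star (ubase x) = uact x (star (ubase x)) - uscal x *\<^sub>C star (ubase x)"
    by (simp add: uact_def)
  also have "norm \<dots> \<le> norm (uact x (star (ubase x))) + cmod (uscal x) * norm (ubase x)"
    using norm_triangle_ineq4 by (metis norm_scaleC norm_star)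
  also have "\<dots> \<le> norm x * norm (ubase x) + norm x * norm (ubase x)"
    using norm_uact_le[of x "star (ubase x)"] mult_right_mono[OF norm_uscal_le[of x] norm_ge_zero[of "ubase x"]]
    by simp
  finally show ?thesis using False by simp
qed (metis norm_ge_zero norm_zero norm_uscal_le order_trans mult_nonneg_nonneg zero_le_numeral)

instance
proof
  fix x y :: "'a unitization" and r s :: real
  show "r *\<^sub>R (x + y) = r *\<^sub>R x + r *\<^sub>R y" "(r + s) *\<^sub>R x = r *\<^sub>R x + s *\<^sub>R x"
    "r *\<^sub>R s *\<^sub>R x = (r * s) *\<^sub>R x" "1 *\<^sub>R x = x"
    by (auto intro!: unitization_eqI simp: scaleR_unitization_def plus_unitization_def algebra_simps)
  have "norm x = 0 \<Longrightarrow> x = 0"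
    using norm_ubase_le[of x] norm_uscal_le[of x]
    by (auto intro!: unitization_eqI simp: zero_unitization_def)
  moreover have "norm (0 :: 'a unitization) = 0"
    using norm_Unitization_le[of "0 :: 'a" 0] norm_uscal_le[of "0 :: 'a unitization"]
    by (simp add: zero_unitization_def)
  ultimately show "norm x = 0 \<longleftrightarrow> x = 0" by auto
  show "norm (x + y) \<le> norm x + norm y"
  proof (rule norm_unitization_leI)
    fix b
    show "norm (uact (x + y) b) \<le> (norm x + norm y) * norm b"
      unfolding uact_simps distrib_right
      by (rule norm_triangle_le) (intro add_mono norm_uact_le)
    show "cmod (uscal (x + y)) \<le> norm x + norm y"
      by (simp add: plus_unitization_def norm_triangle_mono norm_uscal_le)
  qed
  have "onorm (uact (r *\<^sub>R x)) = \<bar>r\<bar> * onorm (uact x)"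
    using onorm_scaleR[OF bounded_linear_uact, of r x] by (simp flip: uact_simps(5))
  moreover have "cmod (uscal (r *\<^sub>R x)) = \<bar>r\<bar> * cmod (uscal x)"
    by (simp add: scaleR_unitization_def)
  ultimately show "norm (r *\<^sub>R x) = \<bar>r\<bar> * norm x"
    by (simp add: norm_unitization_def max_mult_distrib_left)
qed (simp_all add: sgn_unitization_def dist_unitization_def uniformity_unitization_def open_unitization_def)

end

instance unitization :: (cstar_algebra) banach
proof
  fix X :: "nat \<Rightarrow> 'a unitization"
  assume X: "Cauchy X"
  have "Cauchy (\<lambda>n. ubase (X n))"
  proof (rule metric_CauchyI)
    fix e :: real assume "0 < e"
    then obtain N where N: "\<And>m n. N \<le> m \<Longrightarrow> N \<le> n \<Longrightarrow> norm (X m - X n) < e / 2"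
      using CauchyD[OF X, of "e / 2"] by auto
    have "dist (ubase (X m)) (ubase (X n)) < e" if "N \<le> m" "N \<le> n" for m n
      using N[OF that] norm_ubase_le[of "X m - X n"]
      by (simp add: dist_norm minus_unitization_def)
    then show "\<exists>M. \<forall>m\<ge>M. \<forall>n\<ge>M. dist (ubase (X m)) (ubase (X n)) < e" by blast
  qed
  then obtain a where a: "(\<lambda>n. ubase (X n)) \<longlonglongrightarrow> a"
    using Cauchy_convergent convergent_def by blast
  have "Cauchy (\<lambda>n. uscal (X n))"
  proof (rule metric_CauchyI)
    fix e :: real assume "0 < e"
    then obtain N where N: "\<And>m n. N \<le> m \<Longrightarrow> N \<le> n \<Longrightarrow> norm (X m - X n) < e"
      using CauchyD[OF X, of e] by auto
    have "dist (uscal (X m)) (uscal (X n)) < e" if "N \<le> m" "N \<le> n" for m n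
      using N[OF that] norm_uscal_le[of "X m - X n"]
      by (simp add: dist_norm minus_unitization_def)
    then show "\<exists>M. \<forall>m\<ge>M. \<forall>n\<ge>M. dist (uscal (X m)) (uscal (X n)) < e" by blast
  qed
  then obtain c where c: "(\<lambda>n. uscal (X n)) \<longlonglongrightarrow> c"
    using Cauchy_convergent convergent_def by blast
  have "(\<lambda>n. norm (ubase (X n) - a) + cmod (uscal (X n) - c)) \<longlonglongrightarrow> 0"
    using tendsto_add[OF a[THEN tendsto_norm_zero[OF LIM_zero]] c[THEN tendsto_norm_zero[OF LIM_zero]]]
    by simp
  then have "(\<lambda>n. X n - Unitization a c) \<longlonglongrightarrow> 0"
    by (rule Lim_null_comparison[rotated])
      (use norm_Unitization_le in \<open>auto simp: minus_unitization_def intro!: always_eventually\<close>)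
  then have "X \<longlonglongrightarrow> Unitization a c" by (rule LIM_zero_cancel)
  then show "convergent X" by (auto simp: convergent_def)
qed

instantiation unitization :: (cstar_algebra) unital_cstar_algebra
begin
definition "star x = Unitization (star (ubase x)) (cnj (uscal x))"

lemma star_uact: "star (uact x b) * c = star b * uact (star x) (c :: 'a)"
  by (simp add: uact_def star_unitization_def star_add star_mult star_scaleC distrib_left
      distrib_right mult_scaleC_left mult_scaleC_right mult.assoc)

lemma norm_unitization_mult_le: "norm (x * y) \<le> norm x * norm (y :: 'a unitization)"
proof (rule norm_unitization_leI)
  fix b
  have "norm (uact (x * y) b) \<le> norm x * norm (uact y b)"
    by (simp add: norm_uact_le)
  also have "\<dots> \<le> norm x * (norm y * norm b)"
    by (intro mult_left_mono norm_uact_le) simp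
  finally show "norm (uact (x * y) b) \<le> norm x * norm y * norm b" by (simp add: mult.assoc)
  show "cmod (uscal (x * y)) \<le> norm x * norm y"
    by (simp add: times_unitization_def norm_mult mult_mono norm_uscal_le)
qed

lemma unitization_cstar_identity: "norm (star x * x) = (norm (x :: 'a unitization))\<^sup>2"
proof -
  have le: "(norm z)\<^sup>2 \<le> norm (star z * z)" for z :: "'a unitization"
  proof -
    let ?C = "norm (star z * z)"
    have "norm z \<le> sqrt ?C"
    proof (rule norm_unitization_leI)
      fix b
      have "(norm (uact z b))\<^sup>2 = norm (star b * uact (star z * z) b)"
        using cstar_identity[of "uact z b"] star_uact[of z b "uact z b"] by simp
      also have "\<dots> \<le> norm b * (?C * norm b)"
        by (rule order_trans[OF norm_mult_ineq]) (simp add: mult_left_mono norm_uact_le del: uact_simps)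
      also have "\<dots> = (sqrt ?C * norm b)\<^sup>2"
        by (simp add: power_mult_distrib power2_eq_square)
      finally show "norm (uact z b) \<le> sqrt ?C * norm b"
        by (rule power2_le_imp_le) simp
      have "(cmod (uscal z))\<^sup>2 = cmod (uscal (star z * z))"
        by (simp add: times_unitization_def star_unitization_def norm_mult power2_eq_square)
      also have "\<dots> \<le> ?C" by (rule norm_uscal_le)
      finally show "cmod (uscal z) \<le> sqrt ?C" by (rule real_le_rsqrt)
    qed
    then have "(norm z)\<^sup>2 \<le> (sqrt ?C)\<^sup>2" by (rule power_mono) simp
    then show ?thesis by simp
  qed
  have ss: "star (star z) = z" for z :: "'a unitization"
    by (rule unitization_eqI) (simp_all add: star_unitization_def star_star)
  have norm_le: "norm z \<le> norm (star z)" for z :: "'a unitization"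
  proof (cases "norm z = 0")
    case False
    have "norm z * norm z \<le> norm (star z) * norm z"
      using le[of z] norm_unitization_mult_le[of "star z" z] by (simp add: power2_eq_square)
    with False show ?thesis by (simp add: mult_right_le_imp_le)
  qed simp
  have "norm (star x) = norm x" using norm_le[of x] norm_le[of "star x"] by (simp add: ss)
  then show ?thesis
    using le[of x] norm_unitization_mult_le[of "star x" x] by (simp add: power2_eq_square)
qed

instance
proof
  fix x y z :: "'a unitization" and r :: real and c :: complex
  note defs = times_unitization_def plus_unitization_def scaleR_unitization_def
    scaleC_unitization_def star_unitization_def one_unitization_def
  show "norm (x * y) \<le> norm x * norm y" by (rule norm_unitization_mult_le)
  show "norm (star x * x) = (norm x)\<^sup>2" by (rule unitization_cstar_identity)
  show "x * y * z = x * (y * z)"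
    by (rule unitization_eqI)
      (simp_all add: defs mult_scaleC_left mult_scaleC_right scaleC_scaleC scaleC_add_right
        mult.assoc distrib_left distrib_right ac_simps)
  show "(x + y) * z = x * z + y * z" "x * (y + z) = x * y + x * z"
    by (rule unitization_eqI; simp add: defs scaleC_add_right scaleC_add_left algebra_simps)+
  show scal: "r *\<^sub>R x = complex_of_real r *\<^sub>C x" for x :: "'a unitization"
    by (rule unitization_eqI) (simp_all add: defs scaleR_eq_scaleC scaleR_conv_of_real)
  show "c *\<^sub>C x * y = c *\<^sub>C (x * y)" "x * c *\<^sub>C y = c *\<^sub>C (x * y)"
    for c and x y :: "'a unitization"
    by (rule unitization_eqI; simp add: defs mult_scaleC_left mult_scaleC_right scaleC_scaleC
        scaleC_add_right ac_simps)+
  then show "r *\<^sub>R x * y = r *\<^sub>R (x * y)" "x * r *\<^sub>R y = r *\<^sub>R (x * y)"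
    by (simp_all add: scal)
  show "1 * x = x" "x * 1 = x"
    by (rule unitization_eqI; simp add: defs scaleC_one)+
  show "star (star x) = x" "star (x + y) = star x + star y" "star (c *\<^sub>C x) = cnj c *\<^sub>C star x"
    "star (x * y) = star y * star x"
    by (rule unitization_eqI; simp add: defs star_star star_add star_scaleC star_mult ac_simps)+
  show "norm (c *\<^sub>C x) = cmod c * norm x"
  proof -
    have le: "norm (c *\<^sub>C z) \<le> cmod c * norm z" for c and z :: "'a unitization"
    proof (rule norm_unitization_leI)
      show "norm (uact (c *\<^sub>C z) b) \<le> cmod c * norm z * norm b" for b
        by (simp add: norm_scaleC mult.assoc mult_left_mono norm_uact_le)
      show "cmod (uscal (c *\<^sub>C z)) \<le> cmod c * norm z"
        by (simp add: scaleC_unitization_def norm_mult mult_left_mono norm_uscal_le)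
    qed
    show ?thesis
    proof (cases "c = 0")
      case True
      then show ?thesis using le[of c x] by simp
    next
      case False
      have "norm x \<le> cmod (inverse c) * norm (c *\<^sub>C x)"
        using le[of "inverse c" "c *\<^sub>C x"] False by (simp add: scaleC_scaleC scaleC_one)
      then have "norm x \<le> norm (c *\<^sub>C x) / cmod c"
        by (simp add: norm_inverse divide_inverse mult.commute)
      with False have "cmod c * norm x \<le> norm (c *\<^sub>C x)"
        by (simp add: pos_le_divide_eq mult.commute)
      then show ?thesis using le[of c x] by simp
    qed
  qed
qed

end

definition uembed :: "'a::cstar_algebra \<Rightarrow> 'a unitization"
  where "uembed a = Unitization a 0"

lemma uembed_add: "uembed (a + b) = uembed a + uembed b"
  by (simp add: uembed_def plus_unitization_def)

lemma uembed_diff: "uembed (a - b) = uembed a - uembed b"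
  by (simp add: uembed_def minus_unitization_def)

lemma uembed_scaleR: "uembed (r *\<^sub>R a) = r *\<^sub>R uembed a"
  by (simp add: uembed_def scaleR_unitization_def)

lemma uembed_mult: "uembed (a * b) = uembed a * uembed b"
  by (simp add: uembed_def times_unitization_def)

lemma uembed_star: "uembed (star a) = star (uembed a)"
  by (simp add: uembed_def star_unitization_def)

lemma uembed_eq_iff [simp]: "uembed a = uembed b \<longleftrightarrow> a = b"
  by (simp add: uembed_def)

lemma norm_uembed [simp]: "norm (uembed a) = norm a"
proof (rule antisym)
  show "norm (uembed a) \<le> norm a"
    using norm_Unitization_le[of a 0] by (simp add: uembed_def)
  have "(norm a)\<^sup>2 = norm (uact (uembed a) (star a))"
    using cstar_identity[of "star a"] by (simp add: uembed_def uact_def star_star)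
  also have "\<dots> \<le> norm (uembed a) * norm a"
    using norm_uact_le[of "uembed a" "star a"] by simp
  finally show "norm a \<le> norm (uembed a)"
    by (cases "norm a = 0") (simp_all add: power2_eq_square)
qed

lemma bounded_linear_uembed: "bounded_linear uembed"
  by (rule bounded_linear_intro[where K = 1]) (simp_all add: uembed_add uembed_scaleR)

lemma uembed_ideal:
  obtains b where "x * uembed a = uembed b"
  by (rule that[of "ubase (x * uembed a)"]) (simp add: uembed_def times_unitization_def)


section \<open>Positivity in a general C*-algebra\<close>

lemma positive_elem_iff_uembed: "positive_elem a \<longleftrightarrow> cstar_nonneg (uembed a)"
proof
  assume "positive_elem a"
  then obtain x where "a = star x * x" by (auto simp: positive_elem_def)
  then show "cstar_nonneg (uembed a)"
    using cstar_nonneg_star_mult_self[of "uembed x"] by (simp add: uembed_mult uembed_star)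
next
  assume "cstar_nonneg (uembed a)"
  then obtain h where h: "cstar_nonneg h" "h * h = uembed a"
    using cstar_nonneg_sqrt by metis
  \<comment> \<open>The scalar component is multiplicative, so that of the root of \<open>a\<close> vanishes.\<close>
  then have "uscal h * uscal h = 0"
    by (metis times_unitization_def uembed_def unitization.sel(2))
  then have hb: "h = uembed (ubase h)"
    by (intro unitization_eqI) (simp_all add: uembed_def)
  have "uembed a = star h * h" by (simp add: h cstar_nonneg_selfadjoint[OF h(1)])
  then have "uembed a = uembed (star (ubase h) * ubase h)"
    using hb by (metis uembed_mult uembed_star)
  then show "positive_elem a" by (auto simp: positive_elem_def)
qed

lemma positive_elem_star_mult_self [simp]: "positive_elem (star x * x)"
  by (auto simp: positive_elem_def)

lemma positive_elem_zero [simp]: "positive_elem 0"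
  using positive_elem_star_mult_self[of 0] by simp

lemma positive_elem_add: "positive_elem a \<Longrightarrow> positive_elem b \<Longrightarrow> positive_elem (a + b)"
  by (simp add: positive_elem_iff_uembed uembed_add cstar_nonneg_add)

lemma positive_elem_sum: "(\<And>i. i \<in> S \<Longrightarrow> positive_elem (f i)) \<Longrightarrow> positive_elem (sum f S)"
  by (induction S rule: infinite_finite_induct) (simp_all add: positive_elem_add)

lemma positive_elem_scaleR: "0 \<le> r \<Longrightarrow> positive_elem a \<Longrightarrow> positive_elem (r *\<^sub>R a)"
  by (simp add: positive_elem_iff_uembed uembed_scaleR cstar_nonneg_scaleR)

lemma positive_elem_limit: "f \<longlonglongrightarrow> a \<Longrightarrow> (\<And>n. positive_elem (f n)) \<Longrightarrow> positive_elem a"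
  unfolding positive_elem_iff_uembed
  by (rule cstar_nonneg_limit[OF bounded_linear.tendsto[OF bounded_linear_uembed]])

lemma positive_elem_norm_mono:
  "positive_elem a \<Longrightarrow> positive_elem (b - a) \<Longrightarrow> norm a \<le> norm b"
  using cstar_nonneg_norm_mono[of "uembed a" "uembed b"]
  by (simp add: positive_elem_iff_uembed uembed_diff)

text \<open>
  If \<open>k\<close> is the square root of \<open>t - b\<close> in the unitization, the element is \<open>(k x)\<^sup>* (k x)\<close>, where \<open>k x\<close>
  lies in the original algebra because that is an ideal.
\<close>

lemma positive_elem_conjugate_bound:
  assumes "star b = b" "norm b \<le> t"
  shows "positive_elem (t *\<^sub>R (star x * x) - star x * b * x)"
proof -
  have "cstar_nonneg (t *\<^sub>R 1 - uembed b)"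
    using assms by (intro cstar_nonneg_scaleR_one_minus) (simp_all flip: uembed_star)
  then obtain k where k: "cstar_nonneg k" "k * k = t *\<^sub>R 1 - uembed b"
    using cstar_nonneg_sqrt by metis
  obtain c where c: "k * uembed x = uembed c" by (rule uembed_ideal)
  have "uembed (star c * c) = star (uembed x) * (k * k) * uembed x"
    by (simp add: uembed_mult uembed_star c[symmetric] star_mult cstar_nonneg_selfadjoint[OF k(1)]
        mult.assoc)
  also have "\<dots> = uembed (t *\<^sub>R (star x * x) - star x * b * x)"
    by (simp add: k uembed_diff uembed_scaleR uembed_mult uembed_star algebra_simps)
  finally show ?thesis using positive_elem_star_mult_self[of c] by simp
qed

text \<open>
  The Cauchy-Schwarz inequality: \<open>p\<close>, \<open>q\<close>, \<open>r\<close> stand for \<open>\<langle>x|x\<rangle>\<close>, \<open>\<langle>y|y\<rangle>\<close>, \<open>\<langle>x|y\<rangle>\<close>, and the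
  hypothesis says that \<open>\<langle>xa - y|xa - y\<rangle>\<close> is positive. The choice \<open>a = r / t\<close> with \<open>t\<close> slightly above
  \<open>\<parallel>p\<parallel>\<close> gives \<open>r\<^sup>* r \<le> t q\<close>.
\<close>

lemma cstar_Cauchy_Schwarz:
  fixes p q r :: "'a::cstar_algebra"
  assumes p: "star p = p"
    and H: "\<And>a. positive_elem (star a * p * a - star a * r - star r * a + q)"
  shows "(norm r)\<^sup>2 \<le> norm p * norm q"
proof -
  have bound: "(norm r)\<^sup>2 \<le> t * norm q" if t: "0 < t" "norm p \<le> t" for t
  proof -
    have "positive_elem ((1 / t\<^sup>2) *\<^sub>R (t *\<^sub>R (star r * r) - star r * p * r)
        + (star ((1 / t) *\<^sub>R r) * p * ((1 / t) *\<^sub>R r) - star ((1 / t) *\<^sub>R r) * r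
           - star r * ((1 / t) *\<^sub>R r) + q))"
      using p t by (intro positive_elem_add positive_elem_scaleR positive_elem_conjugate_bound H) simp_all
    also have "(1 / t\<^sup>2) *\<^sub>R (t *\<^sub>R (star r * r) - star r * p * r)
        + (star ((1 / t) *\<^sub>R r) * p * ((1 / t) *\<^sub>R r) - star ((1 / t) *\<^sub>R r) * r
           - star r * ((1 / t) *\<^sub>R r) + q) = q - (1 / t) *\<^sub>R (star r * r)"
      using t by (simp add: star_scaleR scaleR_right_diff_distrib power2_eq_square)
    finally have "norm ((1 / t) *\<^sub>R (star r * r)) \<le> norm q"
      using t by (intro positive_elem_norm_mono positive_elem_scaleR) simp_all
    with t show ?thesis by (simp add: cstar_identity field_simps)
  qed
  have "(\<lambda>n. (norm p + 1 / real (Suc n)) * norm q) \<longlonglongrightarrow> (norm p + 0) * norm q"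
    by (intro tendsto_intros LIMSEQ_Suc[OF lim_1_over_n])
  moreover have "(norm r)\<^sup>2 \<le> (norm p + 1 / real (Suc n)) * norm q" for n
    by (rule bound) (simp_all add: add_nonneg_pos)
  ultimately show ?thesis
    using LIMSEQ_le_const by fastforce
qed


section \<open>Positive matrices\<close>

lemma positive_mat_index:
  assumes "positive_mat n P"
  obtains X :: "'a::cstar_algebra mat" where
    "\<And>i j. i < n \<Longrightarrow> j < n \<Longrightarrow> P $$ (i, j) = (\<Sum>k<n. star (X $$ (k, i)) * X $$ (k, j))"
proof -
  obtain X where X: "X \<in> carrier_mat n n" "P = mat_star X * X"
    using assms by (auto simp: positive_mat_def)
  show thesis
    by (rule that[of X])
      (use X(1) in \<open>simp add: X(2) mat_star_def scalar_prod_def atLeast0LessThan\<close>)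
qed

lemma positive_mat_hermitian:
  assumes "positive_mat n P" "i < n" "j < n"
  shows "star (P $$ (i, j)) = P $$ (j, i)"
proof -
  obtain X where X: "\<And>i j. i < n \<Longrightarrow> j < n \<Longrightarrow> P $$ (i, j) = (\<Sum>k<n. star (X $$ (k, i)) * X $$ (k, j))"
    using positive_mat_index[OF assms(1)] by blast
  show ?thesis using assms(2,3) by (simp add: X star_sum star_mult star_star)
qed

text \<open>
  For \<open>P = X\<^sup>* X\<close> the sum of the entries is \<open>\<Sum>\<^sub>k y\<^sub>k\<^sup>* y\<^sub>k\<close>, where \<open>y\<^sub>k\<close> is the sum of the \<open>k\<close>-th row of \<open>X\<close>.
\<close>

lemma positive_mat_sum_entries:
  assumes "positive_mat n P"
  shows "positive_elem (\<Sum>i<n. \<Sum>j<n. P $$ (i, j))"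
proof -
  obtain X where X: "\<And>i j. i < n \<Longrightarrow> j < n \<Longrightarrow> P $$ (i, j) = (\<Sum>k<n. star (X $$ (k, i)) * X $$ (k, j))"
    using positive_mat_index[OF assms] by blast
  have "(\<Sum>i<n. \<Sum>j<n. P $$ (i, j)) = (\<Sum>i<n. \<Sum>j<n. \<Sum>k<n. star (X $$ (k, i)) * X $$ (k, j))"
    by (simp add: X)
  also have "\<dots> = (\<Sum>i<n. \<Sum>k<n. \<Sum>j<n. star (X $$ (k, i)) * X $$ (k, j))"
    by (rule sum.cong[OF refl sum.swap])
  also have "\<dots> = (\<Sum>k<n. \<Sum>i<n. \<Sum>j<n. star (X $$ (k, i)) * X $$ (k, j))"
    by (rule sum.swap)
  also have "\<dots> = (\<Sum>k<n. star (\<Sum>i<n. X $$ (k, i)) * (\<Sum>j<n. X $$ (k, j)))"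
    by (simp add: star_sum sum_product)
  finally show ?thesis by (simp add: positive_elem_sum)
qed

text \<open>
  The root is the matrix with first row \<open>c\<close> and zeros elsewhere.
\<close>

lemma positive_mat_gram:
  fixes c :: "nat \<Rightarrow> 'a::cstar_algebra"
  shows "positive_mat n (mat n n (\<lambda>(i, j). star (c i) * c j))"
proof -
  define X where "X = mat n n (\<lambda>(i, j). if i = 0 then c j else 0)"
  have "mat n n (\<lambda>(i, j). star (c i) * c j) = mat_star X * X"
  proof (rule eq_matI)
    fix i j assume "i < dim_row (mat_star X * X)" "j < dim_col (mat_star X * X)"
    then have ij: "i < n" "j < n" by (simp_all add: X_def mat_star_def)
    have "(mat_star X * X) $$ (i, j)
        = (\<Sum>k<n. star (if k = 0 then c i else 0) * (if k = 0 then c j else 0))"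
      using ij by (simp add: X_def mat_star_def scalar_prod_def atLeast0LessThan)
    also have "\<dots> = (\<Sum>k<n. if k = 0 then star (c i) * c j else 0)"
      by (rule sum.cong) simp_all
    also have "\<dots> = star (c i) * c j" using ij by simp
    finally show "mat n n (\<lambda>(i, j). star (c i) * c j) $$ (i, j) = (mat_star X * X) $$ (i, j)"
      using ij by simp
  qed (simp_all add: X_def mat_star_def)
  then show ?thesis by (auto simp: positive_mat_def X_def)
qed


section \<open>The norm of an inner product module\<close>

text \<open>Hilbert modules without completeness, so that the metric is available before completeness is proved.\<close>

locale inner_product_module = cstar_module M act
  for M :: "'m::complex_vector set" and act :: "'m \<Rightarrow> 'a::cstar_algebra \<Rightarrow> 'm" +
  fixes ip :: "'m \<Rightarrow> 'm \<Rightarrow> 'a"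
  assumes ip_add_right: "x \<in> M \<Longrightarrow> y \<in> M \<Longrightarrow> z \<in> M \<Longrightarrow> ip x (y + z) = ip x y + ip x z"
    and ip_scaleC_right: "x \<in> M \<Longrightarrow> y \<in> M \<Longrightarrow> ip x (c *\<^sub>C y) = c *\<^sub>C ip x y"
    and ip_act_right: "x \<in> M \<Longrightarrow> y \<in> M \<Longrightarrow> ip x (act y a) = ip x y * a"
    and ip_star: "x \<in> M \<Longrightarrow> y \<in> M \<Longrightarrow> ip x y = star (ip y x)"
    and ip_positive: "x \<in> M \<Longrightarrow> positive_elem (ip x x)"
    and ip_definite: "x \<in> M \<Longrightarrow> ip x x = 0 \<Longrightarrow> x = 0"
begin

definition mnorm :: "'m \<Rightarrow> real"
  where "mnorm x = sqrt (norm (ip x x))"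

lemma mnorm_nonneg [simp]: "0 \<le> mnorm x"
  by (simp add: mnorm_def)

lemma mnorm_square: "(mnorm x)\<^sup>2 = norm (ip x x)"
  by (simp add: mnorm_def)

lemma zero_closed [simp]: "0 \<in> M"
  and add_closed [simp]: "x \<in> M \<Longrightarrow> y \<in> M \<Longrightarrow> x + y \<in> M"
  and diff_closed [simp]: "x \<in> M \<Longrightarrow> y \<in> M \<Longrightarrow> x - y \<in> M"
  and scaleC_closed [simp]: "x \<in> M \<Longrightarrow> c *\<^sub>C x \<in> M"
  using subspace complex_vector.subspace_0 complex_vector.subspace_add
    complex_vector.subspace_diff complex_vector.subspace_scale by blast+

lemma ip_diff_right: "x \<in> M \<Longrightarrow> y \<in> M \<Longrightarrow> z \<in> M \<Longrightarrow> ip x (y - z) = ip x y - ip x z"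
  using ip_add_right[of x "y - z" z] by simp

lemma ip_add_left: "x \<in> M \<Longrightarrow> y \<in> M \<Longrightarrow> z \<in> M \<Longrightarrow> ip (x + y) z = ip x z + ip y z"
  by (metis ip_star ip_add_right star_add add_closed)

lemma ip_diff_left: "x \<in> M \<Longrightarrow> y \<in> M \<Longrightarrow> z \<in> M \<Longrightarrow> ip (x - y) z = ip x z - ip y z"
  by (metis ip_star ip_diff_right star_diff diff_closed)

lemma ip_act_left: "x \<in> M \<Longrightarrow> y \<in> M \<Longrightarrow> ip (act x a) y = star a * ip x y"
  by (metis ip_star ip_act_right star_mult act_closed)

lemma ip_zero_right [simp]: "x \<in> M \<Longrightarrow> ip x 0 = 0"
  using ip_diff_right[of x 0 0] by simp

lemma ip_zero_left [simp]: "x \<in> M \<Longrightarrow> ip 0 x = 0"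
  using ip_diff_left[of 0 0 x] by simp

lemma ip_selfadjoint: "x \<in> M \<Longrightarrow> star (ip x x) = ip x x"
  using ip_star[of x x] by simp

lemma Cauchy_Schwarz:
  assumes "x \<in> M" "y \<in> M"
  shows "norm (ip x y) \<le> mnorm x * mnorm y"
proof -
  have "(norm (ip x y))\<^sup>2 \<le> norm (ip x x) * norm (ip y y)"
  proof (rule cstar_Cauchy_Schwarz)
    show "star (ip x x) = ip x x" by (rule ip_selfadjoint[OF assms(1)])
    fix a
    have "ip (act x a - y) (act x a - y)
        = star a * ip x x * a - star a * ip x y - star (ip x y) * a + ip y y"
      using assms ip_star[of y x]
      by (simp add: act_closed ip_diff_left ip_diff_right ip_act_left ip_act_right algebra_simps)
    then show "positive_elem (star a * ip x x * a - star a * ip x y - star (ip x y) * a + ip y y)"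
      using ip_positive[of "act x a - y"] assms by (simp add: act_closed)
  qed
  also have "\<dots> = (mnorm x * mnorm y)\<^sup>2"
    by (simp add: power_mult_distrib mnorm_square)
  finally show ?thesis by (rule power2_le_imp_le) simp
qed

lemma mnorm_triangle:
  assumes "x \<in> M" "y \<in> M"
  shows "mnorm (x + y) \<le> mnorm x + mnorm y"
proof (rule power2_le_imp_le)
  have "(mnorm (x + y))\<^sup>2 = norm (ip x x + ip x y + (ip y x + ip y y))"
    using assms by (simp add: mnorm_square ip_add_left ip_add_right ac_simps)
  also have "\<dots> \<le> norm (ip x x) + norm (ip x y) + (norm (ip y x) + norm (ip y y))"
    by (intro norm_triangle_mono order_refl)
  also have "\<dots> \<le> (mnorm x)\<^sup>2 + mnorm x * mnorm y + (mnorm y * mnorm x + (mnorm y)\<^sup>2)"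
    using assms by (intro add_mono Cauchy_Schwarz) (simp_all add: mnorm_square)
  finally show "(mnorm (x + y))\<^sup>2 \<le> (mnorm x + mnorm y)\<^sup>2"
    by (simp add: power2_eq_square algebra_simps)
qed simp

lemma mnorm_eq_0_iff: "x \<in> M \<Longrightarrow> mnorm x = 0 \<longleftrightarrow> x = 0"
  using ip_definite[of x] by (auto simp: mnorm_def)

lemma mnorm_diff_commute:
  assumes "x \<in> M" "y \<in> M"
  shows "mnorm (x - y) = mnorm (y - x)"
proof -
  have "ip (x - y) (x - y) = ip (y - x) (y - x)"
    using assms by (simp add: ip_diff_left ip_diff_right)
  then show ?thesis by (simp add: mnorm_def)
qed

lemma hilbert_dist_eq: "x \<in> M \<Longrightarrow> y \<in> M \<Longrightarrow> hilbert_dist M ip x y = mnorm (x - y)"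
  by (simp add: hilbert_dist_def mnorm_def)

lemma Metric_space_hilbert_dist: "Metric_space M (hilbert_dist M ip)"
proof
  show "0 \<le> hilbert_dist M ip x y" for x y by (simp add: hilbert_dist_def)
  show "hilbert_dist M ip x y = hilbert_dist M ip y x" for x y
    using mnorm_diff_commute by (auto simp: hilbert_dist_def mnorm_def)
  show "hilbert_dist M ip x y = 0 \<longleftrightarrow> x = y" if "x \<in> M" "y \<in> M" for x y
    using that by (simp add: hilbert_dist_eq mnorm_eq_0_iff)
  show "hilbert_dist M ip x z \<le> hilbert_dist M ip x y + hilbert_dist M ip y z"
    if "x \<in> M" "y \<in> M" "z \<in> M" for x y z
    using mnorm_triangle[of "x - y" "y - z"] that by (simp add: hilbert_dist_eq)
qed

end

sublocale hilbert_module \<subseteq> inner_product_module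
  by unfold_locales
    (rule ip_add_right ip_scaleC_right ip_act_right ip_star ip_positive ip_definite; assumption)+


section \<open>The kernel of a completely positive map\<close>

text \<open>
  A list of pairs \<open>(b, v)\<close> stands for the vector \<open>\<Sum> \<pi>(b) J v\<close> of the dilation to be constructed, and
  a vector \<open>m\<close> of a dilation for the function \<open>\<phi> b v = \<langle>\<pi>(b) J v|m\<rangle>\<close>. Scalars need no coefficients
  in the lists, as they can be moved into \<open>b\<close>. In this reading \<open>eval_list xs \<phi>\<close> is an inner product.
\<close>

definition eval_list :: "('b \<times> 'v) list \<Rightarrow> ('b \<Rightarrow> 'v \<Rightarrow> 'a) \<Rightarrow> 'a::cstar_algebra"
  where "eval_list xs \<phi> = (\<Sum>(b, v)\<leftarrow>xs. \<phi> b v)"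

lemma eval_list_simps [simp]:
  "eval_list [] \<phi> = 0"
  "eval_list ((b, v) # xs) \<phi> = \<phi> b v + eval_list xs \<phi>"
  "eval_list (xs @ ys) \<phi> = eval_list xs \<phi> + eval_list ys \<phi>"
  by (simp_all add: eval_list_def)

lemma eval_list_add: "eval_list xs (\<phi> + \<psi>) = eval_list xs \<phi> + eval_list xs \<psi>"
  by (induction xs) (auto simp: algebra_simps)

lemma eval_list_diff: "eval_list xs (\<phi> - \<psi>) = eval_list xs \<phi> - eval_list xs \<psi>"
  by (induction xs) auto

lemma eval_list_zero [simp]: "eval_list xs 0 = 0"
  by (induction xs) auto

lemma eval_list_scaleC: "eval_list xs (c *\<^sub>C \<phi>) = c *\<^sub>C eval_list xs \<phi>"
  by (induction xs) (auto simp: scaleC_fun_def scaleC_add_right)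

lemma eval_list_mult: "eval_list xs (\<lambda>b v. \<phi> b v * a) = eval_list xs \<phi> * a"
  by (induction xs) (auto simp: distrib_right)

lemma eval_list_sum_nth:
  "eval_list xs \<phi> = (\<Sum>i<length xs. \<phi> (fst (xs ! i)) (snd (xs ! i)))"
  by (simp add: eval_list_def sum_list_sum_nth atLeast0LessThan case_prod_beta)

lemma eval_list_tendsto:
  assumes "\<And>b v. (\<lambda>n. f n b v) \<longlonglongrightarrow> \<phi> b v"
  shows "(\<lambda>n. eval_list xs (f n)) \<longlonglongrightarrow> eval_list xs \<phi>"
  by (induction xs) (auto intro!: tendsto_add assms)

definition list_scaleC :: "complex \<Rightarrow> ('b::complex_vector \<times> 'v) list \<Rightarrow> ('b \<times> 'v) list"
  where "list_scaleC c = map (\<lambda>(b, v). (c *\<^sub>C b, v))"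

definition list_mult :: "'b::times \<Rightarrow> ('b \<times> 'v) list \<Rightarrow> ('b \<times> 'v) list"
  where "list_mult c = map (\<lambda>(b, v). (c * b, v))"

definition list_act :: "('v \<Rightarrow> 'a \<Rightarrow> 'v) \<Rightarrow> ('b \<times> 'v) list \<Rightarrow> 'a \<Rightarrow> ('b \<times> 'v) list"
  where "list_act act xs a = map (\<lambda>(b, v). (b, act v a)) xs"

lemma eval_list_mult_left: "eval_list (list_mult c xs) \<phi> = eval_list xs (\<lambda>b v. \<phi> (c * b) v)"
  by (induction xs) (auto simp: list_mult_def)

lemma list_mult_list_mult: "list_mult c (list_mult d xs) = list_mult (c * d :: 'b::semigroup_mult) xs"
  by (simp add: list_mult_def comp_def case_prod_unfold mult.assoc)

locale cp_map =
  fixes actV :: "'v::complex_vector \<Rightarrow> 'a::cstar_algebra \<Rightarrow> 'v"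
    and E :: "'b::unital_cstar_algebra \<Rightarrow> 'v \<Rightarrow> 'v \<Rightarrow> 'a"
  assumes module: "cstar_module UNIV actV"
    and cp: "completely_positive actV E"
begin

lemma E_add: "E (b + c) v w = E b v w + E c v w"
  and E_scaleC: "E (k *\<^sub>C b) v w = k *\<^sub>C E b v w"
  and E_add_right: "E b v (w + w') = E b v w + E b v w'"
  and E_scaleC_right: "E b v (k *\<^sub>C w) = k *\<^sub>C E b v w"
  and E_act_right: "E b v (actV w a) = E b v w * a"
  using cp by (simp_all add: completely_positive_def sesquilinear_maps_def scaleC_fun_def)

text \<open>The Gram matrix \<open>(b\<^sub>i\<^sup>* b\<^sub>j)\<close> is positive, which is where complete positivity enters.\<close>

lemma positive_mat_E_gram:
  fixes c :: "nat \<Rightarrow> 'b" and v :: "nat \<Rightarrow> 'v"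
  shows "positive_mat n (mat n n (\<lambda>(i, j). E (star (c i) * c j) (v i) (v j)))"
proof -
  have "positive_mat n (mat n n (\<lambda>(i, j).
      E (mat n n (\<lambda>(i, j). star (c i) * c j) $$ (i, j)) (v i) (v j)))"
    using cp positive_mat_gram[of n c] by (simp add: completely_positive_def)
  also have "mat n n (\<lambda>(i, j). E (mat n n (\<lambda>(i, j). star (c i) * c j) $$ (i, j)) (v i) (v j))
      = mat n n (\<lambda>(i, j). E (star (c i) * c j) (v i) (v j))"
    by (rule eq_matI) simp_all
  finally show ?thesis .
qed

text \<open>
  A positive matrix is hermitian; the identity is read off from the Gram matrix of two vectors.
\<close>

lemma E_hermitian: "star (E (star b * c) v w) = E (star c * b) w v"
  using positive_mat_hermitian[OF positive_mat_E_gram[of 2 "\<lambda>i. if i = 0 then b else c"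
        "\<lambda>i. if i = 0 then v else w"], of 0 1]
  by simp

text \<open>
  \<open>ker xs\<close> is the function that corresponds to the vector \<open>\<Sum> \<pi>(b) J v\<close>, and \<open>gram xs ys\<close> is the inner
  product of two such vectors.
\<close>

definition ker :: "('b \<times> 'v) list \<Rightarrow> 'b \<Rightarrow> 'v \<Rightarrow> 'a"
  where "ker xs b v = eval_list xs (\<lambda>c w. E (star b * c) v w)"

definition gram :: "('b \<times> 'v) list \<Rightarrow> ('b \<times> 'v) list \<Rightarrow> 'a"
  where "gram xs ys = eval_list xs (ker ys)"

definition list_norm :: "('b \<times> 'v) list \<Rightarrow> real"
  where "list_norm xs = sqrt (norm (gram xs xs))"

lemma list_norm_nonneg [simp]: "0 \<le> list_norm xs"
  by (simp add: list_norm_def)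

lemma list_norm_square: "(list_norm xs)\<^sup>2 = norm (gram xs xs)"
  by (simp add: list_norm_def)

lemma ker_Nil [simp]: "ker [] = 0"
  by (simp add: fun_eq_iff ker_def)

lemma ker_append: "ker (xs @ ys) = ker xs + ker ys"
  by (simp add: fun_eq_iff ker_def)

lemma ker_scaleC: "ker (list_scaleC c xs) = c *\<^sub>C ker xs"
  by (induction xs)
    (auto simp: fun_eq_iff ker_def list_scaleC_def scaleC_fun_def mult_scaleC_right E_scaleC scaleC_add_right)

lemma ker_diff: "ker (xs @ list_scaleC (- 1) ys) = ker xs - ker ys"
  by (simp add: ker_append ker_scaleC complex_vector.scale_minus_left scaleC_one)

lemma ker_act: "ker (list_act actV xs a) = (\<lambda>b v. ker xs b v * a)"
  by (induction xs) (auto simp: fun_eq_iff ker_def list_act_def E_act_right distrib_right)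

lemma ker_mult: "ker (list_mult c xs) = (\<lambda>b v. ker xs (star c * b) v)"
  by (simp add: fun_eq_iff ker_def eval_list_mult_left star_mult star_star mult.assoc)

lemma ker_add_left: "ker xs (b + c) v = ker xs b v + ker xs c v"
  by (induction xs) (auto simp: ker_def star_add distrib_right E_add)

lemma ker_diff_left: "ker xs (b - c) v = ker xs b v - ker xs c v"
  using ker_add_left[of xs "b - c" c v] by simp

lemma ker_scaleC_left: "ker xs (k *\<^sub>C b) v = cnj k *\<^sub>C ker xs b v"
  by (induction xs) (auto simp: ker_def star_scaleC mult_scaleC_left E_scaleC scaleC_add_right)

lemma gram_star: "star (gram xs ys) = gram ys xs"
proof -
  have "star (gram xs ys)
      = (\<Sum>i<length xs. \<Sum>j<length ys. star (E (star (fst (xs ! i)) * fst (ys ! j)) (snd (xs ! i)) (snd (ys ! j))))"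
    by (simp add: gram_def ker_def eval_list_sum_nth star_sum)
  also have "\<dots> = gram ys xs"
    unfolding E_hermitian by (subst sum.swap) (simp add: gram_def ker_def eval_list_sum_nth)
  finally show ?thesis .
qed

lemma gram_positive: "positive_elem (gram xs xs)"
  using positive_mat_sum_entries[OF positive_mat_E_gram[of "length xs" "\<lambda>i. fst (xs ! i)" "\<lambda>i. snd (xs ! i)"]]
  by (simp add: gram_def ker_def eval_list_sum_nth)

lemma gram_diff_right: "gram zs (xs @ list_scaleC (- 1) ys) = gram zs xs - gram zs ys"
  by (simp add: gram_def ker_diff eval_list_diff)

lemma gram_diff_left: "gram (xs @ list_scaleC (- 1) ys) zs = gram xs zs - gram ys zs"
  by (metis gram_star gram_diff_right star_diff)

lemma gram_act_right: "gram zs (list_act actV xs a) = gram zs xs * a"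
  by (simp add: gram_def ker_act eval_list_mult)

lemma gram_act_left: "gram (list_act actV xs a) zs = star a * gram xs zs"
  by (metis gram_star gram_act_right star_mult)

lemma gram_mult_left: "gram (list_mult c xs) ys = gram xs (list_mult (star c) ys)"
  by (simp add: gram_def eval_list_mult_left ker_mult star_star)

lemma norm_gram_le: "norm (gram xs ys) \<le> list_norm xs * list_norm ys"
proof -
  have "(norm (gram xs ys))\<^sup>2 \<le> norm (gram xs xs) * norm (gram ys ys)"
  proof (rule cstar_Cauchy_Schwarz)
    show "star (gram xs xs) = gram xs xs" by (rule gram_star)
    show "positive_elem (star a * gram xs xs * a - star a * gram xs ys - star (gram xs ys) * a + gram ys ys)" for a
      using gram_positive[of "list_act actV xs a @ list_scaleC (- 1) ys"]
      by (simp add: gram_diff_left gram_diff_right gram_act_left gram_act_right gram_star algebra_simps)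
  qed
  also have "\<dots> = (list_norm xs * list_norm ys)\<^sup>2"
    by (simp add: power_mult_distrib list_norm_square)
  finally show ?thesis by (rule power2_le_imp_le) simp
qed

text \<open>
  Left multiplication by \<open>c\<close> is bounded because \<open>\<parallel>c\<parallel>\<^sup>2 - c\<^sup>* c = d\<^sup>2\<close> for a selfadjoint \<open>d\<close>, so that the
  difference of the two Gram sums is the Gram sum of the list multiplied by \<open>d\<close>.
\<close>

lemma list_norm_mult_le: "list_norm (list_mult c xs) \<le> norm c * list_norm xs"
proof -
  have "cstar_nonneg ((norm c)\<^sup>2 *\<^sub>R 1 - star c * c)"
    by (rule cstar_nonneg_scaleR_one_minus) (simp_all add: star_mult star_star cstar_identity)
  then obtain d where d: "cstar_nonneg d" "d * d = (norm c)\<^sup>2 *\<^sub>R 1 - star c * c"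
    using cstar_nonneg_sqrt by metis
  have comp: "gram (list_mult e xs) (list_mult e xs) = gram xs (list_mult (star e * e) xs)" for e
    by (simp add: gram_mult_left list_mult_list_mult)
  have "gram (list_mult d xs) (list_mult d xs)
      = (norm c)\<^sup>2 *\<^sub>R gram xs xs - gram (list_mult c xs) (list_mult c xs)"
  proof -
    have dd: "d * d = complex_of_real ((norm c)\<^sup>2) *\<^sub>C 1 - star c * c"
      by (simp add: d(2) scaleR_eq_scaleC)
    have "ker (list_mult (d * d) xs) = complex_of_real ((norm c)\<^sup>2) *\<^sub>C ker xs - ker (list_mult (star c * c) xs)"
      unfolding ker_mult dd
      by (simp add: fun_eq_iff scaleC_fun_def star_diff star_scaleC left_diff_distrib
          mult_scaleC_left ker_diff_left ker_scaleC_left)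
    then show ?thesis
      unfolding comp cstar_nonneg_selfadjoint[OF d(1)]
      by (simp add: gram_def eval_list_diff eval_list_scaleC scaleR_eq_scaleC)
  qed
  then have "norm (gram (list_mult c xs) (list_mult c xs)) \<le> norm ((norm c)\<^sup>2 *\<^sub>R gram xs xs)"
    by (intro positive_elem_norm_mono gram_positive) (metis gram_positive)
  then have "(list_norm (list_mult c xs))\<^sup>2 \<le> (norm c * list_norm xs)\<^sup>2"
    by (simp add: list_norm_square power_mult_distrib)
  then show ?thesis by (rule power2_le_imp_le) simp
qed

end


section \<open>The reproducing kernel module\<close>

context cp_map
begin

text \<open>
  \<open>bounded_by \<phi> C\<close> says that \<open>\<phi>\<close>, read as a functional on lists, has norm at most \<open>C\<close>. This norm is
  intrinsic to \<open>\<phi>\<close>, so that the completion of the span of the kernel functions can be formed as a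
  closure inside the function space.
\<close>

definition bounded_by :: "('b \<Rightarrow> 'v \<Rightarrow> 'a) \<Rightarrow> real \<Rightarrow> bool"
  where "bounded_by \<phi> C \<longleftrightarrow> 0 \<le> C \<and> (\<forall>xs. norm (eval_list xs \<phi>) \<le> C * list_norm xs)"

definition rk_module :: "('b \<Rightarrow> 'v \<Rightarrow> 'a) set"
  where "rk_module = {\<phi>. \<forall>e>0. \<exists>xs. bounded_by (\<phi> - ker xs) e}"

definition approximates :: "(nat \<Rightarrow> ('b \<times> 'v) list) \<Rightarrow> ('b \<Rightarrow> 'v \<Rightarrow> 'a) \<Rightarrow> bool"
  where "approximates X \<phi> \<longleftrightarrow> (\<exists>e. e \<longlonglongrightarrow> 0 \<and> (\<forall>n. bounded_by (\<phi> - ker (X n)) (e n)))"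

text \<open>
  By \<open>rk_ip_tendsto\<close> every approximating sequence yields the same limit.
\<close>

definition rk_ip :: "('b \<Rightarrow> 'v \<Rightarrow> 'a) \<Rightarrow> ('b \<Rightarrow> 'v \<Rightarrow> 'a) \<Rightarrow> 'a"
  where "rk_ip \<phi> \<psi> = lim (\<lambda>n. eval_list ((SOME X. approximates X \<phi>) n) \<psi>)"

definition rk_act :: "('b \<Rightarrow> 'v \<Rightarrow> 'a) \<Rightarrow> 'a \<Rightarrow> 'b \<Rightarrow> 'v \<Rightarrow> 'a"
  where "rk_act \<phi> a = (\<lambda>b v. \<phi> b v * a)"

definition rk_rep :: "'b \<Rightarrow> ('b \<Rightarrow> 'v \<Rightarrow> 'a) \<Rightarrow> 'b \<Rightarrow> 'v \<Rightarrow> 'a"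
  where "rk_rep c \<phi> = (\<lambda>b v. \<phi> (star c * b) v)"

lemma bounded_by_nonneg: "bounded_by \<phi> C \<Longrightarrow> 0 \<le> C"
  by (simp add: bounded_by_def)

lemma bounded_byD: "bounded_by \<phi> C \<Longrightarrow> norm (eval_list xs \<phi>) \<le> C * list_norm xs"
  by (simp add: bounded_by_def)

text \<open>
  This is the Cauchy-Schwarz inequality for the Gram sums.
\<close>

lemma bounded_by_ker: "bounded_by (ker xs) (list_norm xs)"
  using norm_gram_le[of _ xs] by (simp add: bounded_by_def gram_def mult.commute)

lemma bounded_by_add:
  assumes "bounded_by \<phi> C" "bounded_by \<psi> D"
  shows "bounded_by (\<phi> + \<psi>) (C + D)"
  unfolding bounded_by_def eval_list_add distrib_right
  using assms by (blast intro: norm_triangle_mono bounded_byD add_nonneg_nonneg bounded_by_nonneg)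

lemma bounded_by_scaleC: "bounded_by \<phi> C \<Longrightarrow> bounded_by (c *\<^sub>C \<phi>) (cmod c * C)"
  unfolding bounded_by_def eval_list_scaleC by (simp add: norm_scaleC mult.assoc mult_left_mono)

lemma bounded_by_minus: "bounded_by \<phi> C \<Longrightarrow> bounded_by (- \<phi>) C"
  using bounded_by_scaleC[of \<phi> C "- 1"] by (simp add: complex_vector.scale_minus_left scaleC_one)

lemma bounded_by_diff:
  assumes "bounded_by \<phi> C" "bounded_by \<psi> D"
  shows "bounded_by (\<phi> - \<psi>) (C + D)"
  using bounded_by_add[OF assms(1) bounded_by_minus[OF assms(2)]] by simp

lemma bounded_by_mono:
  assumes "bounded_by \<phi> C" "C \<le> D"
  shows "bounded_by \<phi> D"
  unfolding bounded_by_def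
proof (intro conjI allI)
  show "0 \<le> D" using bounded_by_nonneg[OF assms(1)] assms(2) by simp
  show "norm (eval_list xs \<phi>) \<le> D * list_norm xs" for xs
    by (rule order_trans[OF bounded_byD[OF assms(1)] mult_right_mono[OF assms(2)]]) simp
qed

lemma bounded_by_act: "bounded_by \<phi> C \<Longrightarrow> bounded_by (rk_act \<phi> a) (C * norm a)"
proof -
  assume C: "bounded_by \<phi> C"
  have "norm (eval_list xs (rk_act \<phi> a)) \<le> (C * list_norm xs) * norm a" for xs
    unfolding rk_act_def eval_list_mult
    by (rule order_trans[OF norm_mult_ineq mult_right_mono[OF bounded_byD[OF C] norm_ge_zero]])
  then show ?thesis using bounded_by_nonneg[OF C] by (simp add: bounded_by_def ac_simps)
qed

lemma bounded_by_rep: "bounded_by \<phi> C \<Longrightarrow> bounded_by (rk_rep c \<phi>) (C * norm c)"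
proof -
  assume C: "bounded_by \<phi> C"
  have "norm (eval_list xs (rk_rep c \<phi>)) \<le> C * (norm c * list_norm xs)" for xs
  proof -
    have "norm (eval_list xs (rk_rep c \<phi>)) \<le> C * list_norm (list_mult (star c) xs)"
      using bounded_byD[OF C] by (simp add: rk_rep_def flip: eval_list_mult_left)
    also have "\<dots> \<le> C * (norm c * list_norm xs)"
      using list_norm_mult_le[of "star c" xs] bounded_by_nonneg[OF C] by (simp add: mult_left_mono)
    finally show ?thesis .
  qed
  then show ?thesis using bounded_by_nonneg[OF C] by (simp add: bounded_by_def mult.assoc)
qed

text \<open>
  The functional norm of a kernel function is attained at the list itself.
\<close>

lemma list_norm_le: "bounded_by (ker xs) C \<Longrightarrow> list_norm xs \<le> C"
proof -
  assume C: "bounded_by (ker xs) C"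
  have "list_norm xs * list_norm xs \<le> C * list_norm xs"
    using bounded_byD[OF C, of xs] list_norm_square[of xs] by (simp add: gram_def power2_eq_square)
  then show ?thesis
    using bounded_by_nonneg[OF C] by (cases "list_norm xs = 0") (auto dest: mult_right_le_imp_le simp: less_le)
qed

lemma approximatesI:
  assumes "\<And>n. bounded_by (\<phi> - ker (X n)) (e n)" "e \<longlonglongrightarrow> 0"
  shows "approximates X \<phi>"
  using assms by (auto simp: approximates_def)

lemma rk_module_approximable:
  assumes "\<phi> \<in> rk_module"
  obtains X where "approximates X \<phi>"
proof -
  have "\<exists>xs. bounded_by (\<phi> - ker xs) (1 / real (Suc n))" for n
    using assms by (simp add: rk_module_def)
  then obtain X where "\<And>n. bounded_by (\<phi> - ker (X n)) (1 / real (Suc n))" by metis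
  then have "approximates X \<phi>"
    by (rule approximatesI) (rule LIMSEQ_Suc[OF lim_1_over_n])
  then show thesis by (rule that)
qed

lemma approximates_imp_mem:
  assumes "approximates X \<phi>"
  shows "\<phi> \<in> rk_module"
proof -
  obtain e where e: "e \<longlonglongrightarrow> 0" "\<And>n. bounded_by (\<phi> - ker (X n)) (e n)"
    using assms by (auto simp: approximates_def)
  have "\<exists>xs. bounded_by (\<phi> - ker xs) d" if "0 < d" for d
  proof -
    have "\<forall>\<^sub>F n in sequentially. e n < d" by (rule order_tendstoD(2)[OF e(1) that])
    then obtain n where "e n < d" by (auto simp: eventually_sequentially)
    then show ?thesis using bounded_by_mono[OF e(2)[of n], of d] by auto
  qed
  then show ?thesis by (simp add: rk_module_def)
qed

lemma rk_module_bounded: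
  assumes "\<phi> \<in> rk_module"
  obtains C where "bounded_by \<phi> C"
proof -
  have "\<exists>xs. bounded_by (\<phi> - ker xs) 1" using assms by (simp add: rk_module_def)
  then obtain xs where "bounded_by (\<phi> - ker xs) 1" by blast
  from bounded_by_add[OF this bounded_by_ker[of xs]] have "bounded_by \<phi> (1 + list_norm xs)" by simp
  then show thesis by (rule that)
qed

lemma approximates_ker: "approximates (\<lambda>_. xs) (ker xs)"
  by (rule approximatesI[where e = "\<lambda>_. 0"])
    (auto simp: bounded_by_def eval_list_diff)

lemma ker_mem [simp]: "ker xs \<in> rk_module"
  by (rule approximates_imp_mem[OF approximates_ker])

lemma approximates_add:
  assumes "approximates X \<phi>" "approximates Y \<psi>"
  shows "approximates (\<lambda>n. X n @ Y n) (\<phi> + \<psi>)"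
proof -
  obtain e f where "e \<longlonglongrightarrow> 0" "\<And>n. bounded_by (\<phi> - ker (X n)) (e n)"
      "f \<longlonglongrightarrow> 0" "\<And>n. bounded_by (\<psi> - ker (Y n)) (f n)"
    using assms by (auto simp: approximates_def)
  then show ?thesis
    using bounded_by_add[of "\<phi> - ker (X n)" "e n" "\<psi> - ker (Y n)" "f n" for n]
    by (intro approximatesI[where e = "\<lambda>n. e n + f n"])
      (auto simp: ker_append add_diff_add intro!: tendsto_add_zero)
qed

lemma approximates_scaleC:
  assumes "approximates X \<phi>"
  shows "approximates (\<lambda>n. list_scaleC c (X n)) (c *\<^sub>C \<phi>)"
proof -
  obtain e where "e \<longlonglongrightarrow> 0" "\<And>n. bounded_by (\<phi> - ker (X n)) (e n)"
    using assms by (auto simp: approximates_def)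
  then show ?thesis
    by (intro approximatesI[where e = "\<lambda>n. cmod c * e n"])
      (auto simp: ker_scaleC intro!: tendsto_mult_right_zero bounded_by_scaleC
        simp flip: complex_vector.scale_right_diff_distrib)
qed

lemma approximates_act:
  assumes "approximates X \<phi>"
  shows "approximates (\<lambda>n. list_act actV (X n) a) (rk_act \<phi> a)"
proof -
  obtain e where e: "e \<longlonglongrightarrow> 0" "\<And>n. bounded_by (\<phi> - ker (X n)) (e n)"
    using assms by (auto simp: approximates_def)
  have "rk_act \<phi> a - ker (list_act actV (X n) a) = rk_act (\<phi> - ker (X n)) a" for n
    by (simp add: fun_eq_iff rk_act_def ker_act left_diff_distrib)
  with e show ?thesis
    by (intro approximatesI[where e = "\<lambda>n. e n * norm a"])
      (auto intro!: tendsto_mult_left_zero bounded_by_act)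
qed

lemma approximates_rep:
  assumes "approximates X \<phi>"
  shows "approximates (\<lambda>n. list_mult c (X n)) (rk_rep c \<phi>)"
proof -
  obtain e where e: "e \<longlonglongrightarrow> 0" "\<And>n. bounded_by (\<phi> - ker (X n)) (e n)"
    using assms by (auto simp: approximates_def)
  have "rk_rep c \<phi> - ker (list_mult c (X n)) = rk_rep c (\<phi> - ker (X n))" for n
    by (simp add: fun_eq_iff rk_rep_def ker_mult)
  with e show ?thesis
    by (intro approximatesI[where e = "\<lambda>n. e n * norm c"])
      (auto intro!: tendsto_mult_left_zero bounded_by_rep)
qed

lemma rk_module_add: "\<phi> \<in> rk_module \<Longrightarrow> \<psi> \<in> rk_module \<Longrightarrow> \<phi> + \<psi> \<in> rk_module"
  by (meson rk_module_approximable approximates_add approximates_imp_mem)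

lemma rk_module_scaleC: "\<phi> \<in> rk_module \<Longrightarrow> c *\<^sub>C \<phi> \<in> rk_module"
  by (meson rk_module_approximable approximates_scaleC approximates_imp_mem)

lemma rk_module_act: "\<phi> \<in> rk_module \<Longrightarrow> rk_act \<phi> a \<in> rk_module"
  by (meson rk_module_approximable approximates_act approximates_imp_mem)

lemma rk_module_rep: "\<phi> \<in> rk_module \<Longrightarrow> rk_rep c \<phi> \<in> rk_module"
  by (meson rk_module_approximable approximates_rep approximates_imp_mem)

lemma rk_module_subspace: "complex_vector.subspace rk_module"
  unfolding complex_vector.subspace_def
  using ker_mem[of "[]"] rk_module_add rk_module_scaleC by simp

text \<open>
  Evaluation at \<open>(b, v)\<close> is the pairing with a one-element list, hence continuous. Identities between
  values of kernel functions therefore pass to all elements of the module.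
\<close>

lemma approximates_pointwise:
  assumes "approximates X \<phi>"
  shows "(\<lambda>n. ker (X n) b v) \<longlonglongrightarrow> \<phi> b v"
proof -
  obtain e where e: "e \<longlonglongrightarrow> 0" "\<And>n. bounded_by (\<phi> - ker (X n)) (e n)"
    using assms by (auto simp: approximates_def)
  have "norm (ker (X n) b v - \<phi> b v) \<le> e n * list_norm [(b, v)]" for n
    using bounded_byD[OF e(2)[of n], of "[(b, v)]"] by (simp add: norm_minus_commute)
  moreover have "(\<lambda>n. e n * list_norm [(b, v)]) \<longlonglongrightarrow> 0"
    using e(1) by (rule tendsto_mult_left_zero)
  ultimately have "(\<lambda>n. ker (X n) b v - \<phi> b v) \<longlonglongrightarrow> 0"
    by (rule Lim_null_comparison[OF always_eventually[OF allI]])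
  then show ?thesis by (rule LIM_zero_cancel)
qed

lemma rk_module_add_left:
  assumes "\<phi> \<in> rk_module"
  shows "\<phi> (b + c) v = \<phi> b v + \<phi> c v"
proof -
  obtain X where "approximates X \<phi>" using assms by (rule rk_module_approximable)
  from tendsto_add[OF this[THEN approximates_pointwise] this[THEN approximates_pointwise], of b v c v]
    approximates_pointwise[OF this, of "b + c" v]
  show ?thesis unfolding ker_add_left by (rule LIMSEQ_unique[OF _ , rotated])
qed

lemma rk_module_scaleC_left:
  assumes "\<phi> \<in> rk_module"
  shows "\<phi> (k *\<^sub>C b) v = cnj k *\<^sub>C \<phi> b v"
proof -
  obtain X where "approximates X \<phi>" using assms by (rule rk_module_approximable)
  from bounded_linear.tendsto[OF bounded_linear_scaleC approximates_pointwise[OF this], of "cnj k" b v]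
    approximates_pointwise[OF this, of "k *\<^sub>C b" v]
  show ?thesis unfolding ker_scaleC_left by (rule LIMSEQ_unique[OF _ , rotated])
qed

lemma eval_list_scaleC_list:
  assumes "\<phi> \<in> rk_module"
  shows "eval_list (list_scaleC c xs) \<phi> = cnj c *\<^sub>C eval_list xs \<phi>"
  by (induction xs) (auto simp: list_scaleC_def rk_module_scaleC_left[OF assms] scaleC_add_right)

text \<open>
  As \<open>\<psi>\<close> is antilinear in \<open>b\<close>, the difference is the value at a single list, and this list is short if
  both lists are close to \<open>\<phi>\<close>.
\<close>

lemma eval_list_difference:
  assumes "\<psi> \<in> rk_module" "bounded_by \<psi> C"
    and "bounded_by (\<phi> - ker xs) d" "bounded_by (\<phi> - ker ys) e"
  shows "norm (eval_list xs \<psi> - eval_list ys \<psi>) \<le> C * (d + e)"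
proof -
  have "bounded_by (ker (xs @ list_scaleC (- 1) ys)) (d + e)"
    using bounded_by_diff[OF assms(4,3)] by (simp add: ker_diff add.commute)
  then have "list_norm (xs @ list_scaleC (- 1) ys) \<le> d + e" by (rule list_norm_le)
  moreover have "norm (eval_list (xs @ list_scaleC (- 1) ys) \<psi>) \<le> C * list_norm (xs @ list_scaleC (- 1) ys)"
    by (rule bounded_byD[OF assms(2)])
  ultimately show ?thesis
    using mult_left_mono[of "list_norm (xs @ list_scaleC (- 1) ys)" "d + e" C] bounded_by_nonneg[OF assms(2)]
    by (simp add: eval_list_scaleC_list[OF assms(1)] complex_vector.scale_minus_left scaleC_one)
qed

lemma rk_ip_tendsto:
  assumes \<psi>: "\<psi> \<in> rk_module" and X: "approximates X \<phi>"
  shows "(\<lambda>n. eval_list (X n) \<psi>) \<longlonglongrightarrow> rk_ip \<phi> \<psi>"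
proof -
  obtain C where C: "bounded_by \<psi> C" using \<psi> by (rule rk_module_bounded)
  define Y where "Y = (SOME X. approximates X \<phi>)"
  have "approximates Y \<phi>" unfolding Y_def using X by (rule someI[of "\<lambda>X. approximates X \<phi>"])
  then obtain d where d: "d \<longlonglongrightarrow> 0" "\<And>n. bounded_by (\<phi> - ker (Y n)) (d n)"
    by (auto simp: approximates_def)
  obtain e where e: "e \<longlonglongrightarrow> 0" "\<And>n. bounded_by (\<phi> - ker (X n)) (e n)"
    using X by (auto simp: approximates_def)
  have "Cauchy (\<lambda>n. eval_list (Y n) \<psi>)"
  proof (rule CauchyI)
    fix r :: real assume r: "0 < r"
    have "(\<lambda>n. C * (d n + d n)) \<longlonglongrightarrow> C * (0 + 0)" by (intro tendsto_intros d(1))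
    then have "\<forall>\<^sub>F n in sequentially. C * (d n + d n) < r"
      using r by (intro order_tendstoD(2)) simp_all
    then obtain N where N: "\<And>n. N \<le> n \<Longrightarrow> C * (d n + d n) < r"
      by (auto simp: eventually_sequentially)
    have "norm (eval_list (Y m) \<psi> - eval_list (Y n) \<psi>) < r" if "N \<le> m" "N \<le> n" for m n
    proof -
      have "norm (eval_list (Y m) \<psi> - eval_list (Y n) \<psi>) \<le> C * (d m + d n)"
        by (rule eval_list_difference[OF \<psi> C d(2) d(2)])
      also have "\<dots> < r"
        using N[OF that(1)] N[OF that(2)] by (simp add: algebra_simps)
      finally show ?thesis .
    qed
    then show "\<exists>M. \<forall>m\<ge>M. \<forall>n\<ge>M. norm (eval_list (Y m) \<psi> - eval_list (Y n) \<psi>) < r" by blast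
  qed
  then have lim: "(\<lambda>n. eval_list (Y n) \<psi>) \<longlonglongrightarrow> rk_ip \<phi> \<psi>"
    unfolding rk_ip_def Y_def[symmetric] using Cauchy_convergent_iff convergent_LIMSEQ_iff by blast
  have "(\<lambda>n. eval_list (X n) \<psi> - eval_list (Y n) \<psi>) \<longlonglongrightarrow> 0"
  proof (rule Lim_null_comparison[of _ "\<lambda>n. C * (e n + d n)"])
    show "\<forall>\<^sub>F n in sequentially. norm (eval_list (X n) \<psi> - eval_list (Y n) \<psi>) \<le> C * (e n + d n)"
      using eval_list_difference[OF \<psi> C e(2) d(2)] by simp
    show "(\<lambda>n. C * (e n + d n)) \<longlonglongrightarrow> 0"
      by (intro tendsto_mult_right_zero tendsto_add_zero e(1) d(1))
  qed
  from tendsto_add[OF this lim] show ?thesis by simp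
qed

lemma rk_ip_ker: "\<psi> \<in> rk_module \<Longrightarrow> rk_ip (ker xs) \<psi> = eval_list xs \<psi>"
  using rk_ip_tendsto[OF _ approximates_ker, of \<psi> xs] by (simp add: LIMSEQ_const_iff)

lemma gram_tendsto_rk_ip:
  assumes X: "approximates X \<phi>" and Y: "approximates Y \<psi>"
  shows "(\<lambda>n. gram (X n) (Y n)) \<longlonglongrightarrow> rk_ip \<phi> \<psi>"
proof -
  obtain e where e: "e \<longlonglongrightarrow> 0" "\<And>n. bounded_by (\<phi> - ker (X n)) (e n)"
    using X by (auto simp: approximates_def)
  obtain d where d: "d \<longlonglongrightarrow> 0" "\<And>n. bounded_by (\<psi> - ker (Y n)) (d n)"
    using Y by (auto simp: approximates_def)
  obtain C where C: "bounded_by \<phi> C"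
    using approximates_imp_mem[OF X] by (rule rk_module_bounded)
  have "norm (eval_list (X n) \<psi> - gram (X n) (Y n)) \<le> d n * (C + e n)" for n
  proof -
    have "norm (eval_list (X n) (\<psi> - ker (Y n))) \<le> d n * list_norm (X n)"
      by (rule bounded_byD[OF d(2)])
    moreover have "list_norm (X n) \<le> C + e n"
      using list_norm_le bounded_by_diff[OF C e(2)[of n]] by simp
    ultimately show ?thesis
      using mult_left_mono[of _ _ "d n"] bounded_by_nonneg[OF d(2)[of n]]
      by (fastforce simp: eval_list_diff gram_def)
  qed
  moreover have "(\<lambda>n. d n * (C + e n)) \<longlonglongrightarrow> 0"
    using tendsto_mult[OF d(1) tendsto_add[OF tendsto_const e(1)]] by simp
  ultimately have "(\<lambda>n. eval_list (X n) \<psi> - gram (X n) (Y n)) \<longlonglongrightarrow> 0"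
    by (rule Lim_null_comparison[OF always_eventually[OF allI]])
  from tendsto_diff[OF rk_ip_tendsto[OF approximates_imp_mem[OF Y] X] this] show ?thesis by simp
qed

lemma rk_ip_star:
  assumes "\<phi> \<in> rk_module" "\<psi> \<in> rk_module"
  shows "rk_ip \<phi> \<psi> = star (rk_ip \<psi> \<phi>)"
proof -
  obtain X Y where X: "approximates X \<phi>" and Y: "approximates Y \<psi>"
    using assms rk_module_approximable by metis
  from bounded_linear.tendsto[OF bounded_linear_star gram_tendsto_rk_ip[OF Y X]]
  show ?thesis
    unfolding gram_star by (rule LIMSEQ_unique[OF gram_tendsto_rk_ip[OF X Y]])
qed

lemma rk_ip_positive:
  assumes "\<phi> \<in> rk_module"
  shows "positive_elem (rk_ip \<phi> \<phi>)"
proof -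
  obtain X where "approximates X \<phi>" using assms by (rule rk_module_approximable)
  from gram_tendsto_rk_ip[OF this this] show ?thesis
    by (rule positive_elem_limit) (rule gram_positive)
qed

lemma rk_ip_add_right:
  assumes "\<phi> \<in> rk_module" "\<psi> \<in> rk_module" "\<theta> \<in> rk_module"
  shows "rk_ip \<phi> (\<psi> + \<theta>) = rk_ip \<phi> \<psi> + rk_ip \<phi> \<theta>"
proof -
  obtain X where X: "approximates X \<phi>" using assms(1) by (rule rk_module_approximable)
  have "(\<lambda>n. eval_list (X n) (\<psi> + \<theta>)) \<longlonglongrightarrow> rk_ip \<phi> \<psi> + rk_ip \<phi> \<theta>"
    unfolding eval_list_add by (intro tendsto_add rk_ip_tendsto X assms)
  then show ?thesis by (rule LIMSEQ_unique[OF rk_ip_tendsto[OF rk_module_add[OF assms(2,3)] X]])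
qed

lemma rk_ip_scaleC_right:
  assumes "\<phi> \<in> rk_module" "\<psi> \<in> rk_module"
  shows "rk_ip \<phi> (c *\<^sub>C \<psi>) = c *\<^sub>C rk_ip \<phi> \<psi>"
proof -
  obtain X where X: "approximates X \<phi>" using assms(1) by (rule rk_module_approximable)
  have "(\<lambda>n. eval_list (X n) (c *\<^sub>C \<psi>)) \<longlonglongrightarrow> c *\<^sub>C rk_ip \<phi> \<psi>"
    unfolding eval_list_scaleC
    by (rule bounded_linear.tendsto[OF bounded_linear_scaleC rk_ip_tendsto[OF assms(2) X]])
  then show ?thesis by (rule LIMSEQ_unique[OF rk_ip_tendsto[OF rk_module_scaleC[OF assms(2)] X]])
qed

lemma rk_ip_act_right:
  assumes "\<phi> \<in> rk_module" "\<psi> \<in> rk_module"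
  shows "rk_ip \<phi> (rk_act \<psi> a) = rk_ip \<phi> \<psi> * a"
proof -
  obtain X where X: "approximates X \<phi>" using assms(1) by (rule rk_module_approximable)
  have "(\<lambda>n. eval_list (X n) (rk_act \<psi> a)) \<longlonglongrightarrow> rk_ip \<phi> \<psi> * a"
    unfolding eval_list_mult rk_act_def
    by (intro tendsto_mult tendsto_const rk_ip_tendsto assms X)
  then show ?thesis by (rule LIMSEQ_unique[OF rk_ip_tendsto[OF rk_module_act[OF assms(2)] X]])
qed

text \<open>
  The functional attains the norm given by the inner product, in the limit, along an approximating
  sequence of lists; that it is no larger is the Cauchy-Schwarz inequality in the limit.
\<close>

lemma bounded_by_iff_rk_ip:
  assumes "\<phi> \<in> rk_module"
  shows "bounded_by \<phi> C \<longleftrightarrow> sqrt (norm (rk_ip \<phi> \<phi>)) \<le> C"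
proof -
  obtain X where X: "approximates X \<phi>" using assms by (rule rk_module_approximable)
  let ?r = "sqrt (norm (rk_ip \<phi> \<phi>))"
  have ln: "(\<lambda>n. list_norm (X n)) \<longlonglongrightarrow> ?r"
    unfolding list_norm_def by (intro tendsto_intros gram_tendsto_rk_ip X)
  have r: "bounded_by \<phi> ?r"
    unfolding bounded_by_def
  proof (intro conjI allI)
    fix xs
    have "(\<lambda>n. norm (gram xs (X n))) \<longlonglongrightarrow> norm (eval_list xs \<phi>)"
      using tendsto_norm[OF gram_tendsto_rk_ip[OF approximates_ker X]]
      by (simp add: rk_ip_ker assms)
    moreover have "(\<lambda>n. list_norm xs * list_norm (X n)) \<longlonglongrightarrow> list_norm xs * ?r"
      by (intro tendsto_intros ln)
    ultimately have "norm (eval_list xs \<phi>) \<le> list_norm xs * ?r"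
      by (rule LIMSEQ_le) (simp add: norm_gram_le)
    then show "norm (eval_list xs \<phi>) \<le> ?r * list_norm xs" by (simp add: mult.commute)
  qed simp
  show ?thesis
  proof
    assume "?r \<le> C"
    with r show "bounded_by \<phi> C" by (rule bounded_by_mono)
  next
    assume C: "bounded_by \<phi> C"
    have "norm (rk_ip \<phi> \<phi>) \<le> C * ?r"
      by (rule LIMSEQ_le[OF tendsto_norm[OF rk_ip_tendsto[OF assms X]] tendsto_mult[OF tendsto_const ln]])
        (simp add: bounded_byD[OF C])
    then have le: "?r * ?r \<le> C * ?r" by simp
    show "?r \<le> C"
    proof (cases "0 < ?r")
      case True
      with le show ?thesis by (rule mult_right_le_imp_le)
    next
      case False
      with bounded_by_nonneg[OF C] show ?thesis by linarith
    qed
  qed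
qed

lemma bounded_by_zero_imp:
  assumes "bounded_by \<phi> 0"
  shows "\<phi> = 0"
proof -
  have "\<phi> b v = 0" for b v using bounded_byD[OF assms, of "[(b, v)]"] by simp
  then show ?thesis by (simp add: fun_eq_iff)
qed

lemma cstar_module_rk: "cstar_module rk_module rk_act"
proof
  show "complex_vector.subspace rk_module" by (rule rk_module_subspace)
  show "rk_act \<phi> a \<in> rk_module" if "\<phi> \<in> rk_module" for \<phi> a using that by (rule rk_module_act)
qed (simp_all add: fun_eq_iff rk_act_def scaleC_fun_def algebra_simps mult_scaleC_left mult_scaleC_right)

lemma inner_product_module_rk: "inner_product_module rk_module rk_act rk_ip"
proof -
  interpret cstar_module rk_module rk_act by (rule cstar_module_rk)
  show ?thesis
  proof
    show "\<phi> = 0" if "\<phi> \<in> rk_module" "rk_ip \<phi> \<phi> = 0" for \<phi>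
      using that bounded_by_iff_rk_ip[of \<phi> 0] bounded_by_zero_imp by simp
  qed (fact rk_ip_add_right rk_ip_scaleC_right rk_ip_act_right rk_ip_star rk_ip_positive)+
qed

sublocale rk: inner_product_module rk_module rk_act rk_ip
  by (rule inner_product_module_rk)

sublocale rk_metric: Metric_space rk_module "hilbert_dist rk_module rk_ip"
  by (rule rk.Metric_space_hilbert_dist)

lemma rk_dist_le_iff:
  assumes "\<phi> \<in> rk_module" "\<psi> \<in> rk_module"
  shows "hilbert_dist rk_module rk_ip \<phi> \<psi> \<le> C \<longleftrightarrow> bounded_by (\<phi> - \<psi>) C"
  using assms by (simp add: hilbert_dist_def bounded_by_iff_rk_ip)

text \<open>
  A Cauchy sequence converges pointwise, and since a functional bound is a family of bounds on finite
  sums of values, the Cauchy estimates survive the pointwise limit.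
\<close>

lemma rk_complete: "rk_metric.mcomplete"
  unfolding rk_metric.mcomplete_def
proof (intro allI impI)
  fix \<sigma> assume \<sigma>: "rk_metric.MCauchy \<sigma>"
  then have mem: "\<sigma> n \<in> rk_module" for n
    by (auto simp: rk_metric.MCauchy_def)
  have cauchy: "\<exists>N. \<forall>m\<ge>N. \<forall>n\<ge>N. bounded_by (\<sigma> m - \<sigma> n) e" if "0 < e" for e
    using \<sigma> that by (auto simp: rk_metric.MCauchy_def simp flip: rk_dist_le_iff[OF mem mem]) (meson less_imp_le)
  have "convergent (\<lambda>n. \<sigma> n b v)" for b v
  proof (rule Cauchy_convergent, rule CauchyI)
    fix e :: real assume "0 < e"
    define d where "d = e / (list_norm [(b, v)] + 1)"
    have L: "0 < list_norm [(b, v)] + 1" by (simp add: add_nonneg_pos)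
    have "0 < d" using \<open>0 < e\<close> L by (simp add: d_def)
    then obtain N where N: "\<And>m n. N \<le> m \<Longrightarrow> N \<le> n \<Longrightarrow> bounded_by (\<sigma> m - \<sigma> n) d"
      using cauchy by meson
    have "norm (\<sigma> m b v - \<sigma> n b v) < e" if "N \<le> m" "N \<le> n" for m n
    proof -
      have "norm (\<sigma> m b v - \<sigma> n b v) \<le> d * list_norm [(b, v)]"
        using bounded_byD[OF N[OF that], of "[(b, v)]"] by simp
      also have "\<dots> < d * (list_norm [(b, v)] + 1)"
        using \<open>0 < d\<close> by simp
      also have "\<dots> = e" using L by (simp add: d_def)
      finally show ?thesis .
    qed
    then show "\<exists>M. \<forall>m\<ge>M. \<forall>n\<ge>M. norm (\<sigma> m b v - \<sigma> n b v) < e" by blast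
  qed
  then obtain \<phi> where \<phi>: "\<And>b v. (\<lambda>n. \<sigma> n b v) \<longlonglongrightarrow> \<phi> b v"
    unfolding convergent_def by metis
  have close: "\<exists>N. \<forall>n\<ge>N. bounded_by (\<sigma> n - \<phi>) e" if "0 < e" for e
  proof -
    obtain N where N: "\<And>m n. N \<le> m \<Longrightarrow> N \<le> n \<Longrightarrow> bounded_by (\<sigma> m - \<sigma> n) e"
      using cauchy[OF \<open>0 < e\<close>] by meson
    have "bounded_by (\<sigma> n - \<phi>) e" if n: "N \<le> n" for n
      unfolding bounded_by_def
    proof (intro conjI allI)
      show "0 \<le> e" using \<open>0 < e\<close> by simp
      fix xs
      have "(\<lambda>m. eval_list xs (\<sigma> n - \<sigma> m)) \<longlonglongrightarrow> eval_list xs (\<sigma> n - \<phi>)"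
        by (rule eval_list_tendsto) (auto intro!: tendsto_intros \<phi>)
      then show "norm (eval_list xs (\<sigma> n - \<phi>)) \<le> e * list_norm xs"
        by (rule LIMSEQ_le_const2[OF tendsto_norm]) (use bounded_byD[OF N[OF n]] in blast)
    qed
    then show ?thesis by blast
  qed
  have "\<phi> \<in> rk_module"
    unfolding rk_module_def
  proof (intro CollectI allI impI)
    fix e :: real assume "0 < e"
    then obtain n where n: "bounded_by (\<sigma> n - \<phi>) (e / 2)" using close[of "e / 2"] by auto
    obtain xs where xs: "bounded_by (\<sigma> n - ker xs) (e / 2)"
      using mem[of n] \<open>0 < e\<close> by (auto simp: rk_module_def dest: spec[of _ "e / 2"])
    show "\<exists>xs. bounded_by (\<phi> - ker xs) e"
      using bounded_by_diff[OF xs n] by auto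
  qed
  moreover have "\<exists>N. \<forall>n\<ge>N. hilbert_dist rk_module rk_ip (\<sigma> n) \<phi> < e" if "0 < e" for e
  proof -
    obtain N where "\<And>n. N \<le> n \<Longrightarrow> bounded_by (\<sigma> n - \<phi>) (e / 2)"
      using close[of "e / 2"] \<open>0 < e\<close> by auto
    then have "\<forall>n\<ge>N. hilbert_dist rk_module rk_ip (\<sigma> n) \<phi> \<le> e / 2"
      using rk_dist_le_iff[OF mem \<open>\<phi> \<in> rk_module\<close>] by blast
    moreover have "e / 2 < e" using \<open>0 < e\<close> by simp
    ultimately have "\<forall>n\<ge>N. hilbert_dist rk_module rk_ip (\<sigma> n) \<phi> < e"
      by (meson le_less_trans)
    then show ?thesis by blast
  qed
  ultimately have "limitin rk_metric.mtopology \<sigma> \<phi> sequentially"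
    by (simp add: rk_metric.limit_metric_sequentially mem)
  then show "\<exists>\<phi>. limitin rk_metric.mtopology \<sigma> \<phi> sequentially"
    using exI[of "\<lambda>\<phi>. limitin rk_metric.mtopology \<sigma> \<phi> sequentially" \<phi>] by simp
qed

end


section \<open>The reproducing kernel dilation\<close>

context cp_map
begin

definition rk_emb :: "'v \<Rightarrow> 'b \<Rightarrow> 'v \<Rightarrow> 'a"
  where "rk_emb v = ker [(1, v)]"

lemma rk_rep_emb: "rk_rep b (rk_emb v) = ker [(b, v)]"
  using ker_mult[of b "[(1, v)]"] by (simp add: rk_rep_def rk_emb_def list_mult_def)

lemma rk_rep_adjoint:
  assumes "\<phi> \<in> rk_module" "\<psi> \<in> rk_module"
  shows "rk_ip (rk_rep c \<phi>) \<psi> = rk_ip \<phi> (rk_rep (star c) \<psi>)"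
proof -
  obtain X where X: "approximates X \<phi>" using assms(1) by (rule rk_module_approximable)
  have "(\<lambda>n. eval_list (X n) (rk_rep (star c) \<psi>)) \<longlonglongrightarrow> rk_ip (rk_rep c \<phi>) \<psi>"
    using rk_ip_tendsto[OF assms(2) approximates_rep[OF X, of c]]
    by (simp add: eval_list_mult_left rk_rep_def star_star)
  then show ?thesis
    by (rule LIMSEQ_unique[OF _ rk_ip_tendsto[OF rk_module_rep[OF assms(2)] X]])
qed

lemma rk_unital_star_hom: "unital_star_hom rk_module rk_ip rk_rep"
proof -
  have adj: "is_adjoint rk_module rk_ip (rk_rep b) (rk_rep (star b))" for b
    by (simp add: is_adjoint_def rk_module_rep rk_rep_adjoint)
  then have "rk_rep b \<in> adjointable_maps rk_module rk_ip" for b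
    by (auto simp: adjointable_maps_def)
  with adj show ?thesis
    by (simp add: unital_star_hom_def fun_eq_iff rk_rep_def star_add star_scaleC star_mult distrib_right
        mult_scaleC_left rk_module_add_left rk_module_scaleC_left scaleC_fun_def mult.assoc)
qed

lemma rk_emb_Lin: "rk_emb \<in> Lin UNIV actV rk_module rk_act"
  unfolding Lin_def rk_emb_def
  by (auto simp: fun_eq_iff ker_def rk_act_def scaleC_fun_def E_add_right E_scaleC_right E_act_right)

lemma ker_mem_span: "ker xs \<in> complex_vector.span {rk_rep b (rk_emb v) | b v. True}"
proof (induction xs)
  case Nil
  show ?case unfolding ker_Nil by (rule complex_vector.span_zero)
next
  case (Cons x xs)
  obtain b v where x: "x = (b, v)" by (cases x)
  have "ker (x # xs) = rk_rep b (rk_emb v) + ker xs"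
    using ker_append[of "[x]" xs] unfolding x rk_rep_emb by simp
  moreover have "rk_rep b (rk_emb v) + ker xs \<in> complex_vector.span {rk_rep b (rk_emb v) | b v. True}"
    by (rule complex_vector.span_add[OF complex_vector.span_base Cons]) blast
  ultimately show ?case by (simp only:)
qed

theorem rk_minimal_dilation: "minimal_dilation actV E rk_module rk_act rk_ip rk_rep rk_emb"
  unfolding minimal_dilation_def
proof (intro conjI allI)
  show "hilbert_module rk_module rk_act rk_ip"
    by (intro hilbert_module.intro hilbert_module_axioms.intro cstar_module_rk rk.ip_add_right
        rk.ip_scaleC_right rk.ip_act_right rk.ip_star rk.ip_positive rk.ip_definite rk_complete)
  show "unital_star_hom rk_module rk_ip rk_rep" by (rule rk_unital_star_hom)
  show "rk_emb \<in> Lin UNIV actV rk_module rk_act" by (rule rk_emb_Lin)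
  fix b v v'
  have "rk_ip (rk_emb v) (rk_rep b (rk_emb v')) = E b v v'"
    unfolding rk_rep_emb by (simp add: rk_emb_def rk_ip_ker ker_def)
  then show "E b v v' = pairing v (cross rk_ip rk_emb (rk_rep b (rk_emb v')))"
    by (simp add: pairing_def cross_def)
  show "pairing v (cross rk_ip rk_emb (rk_rep b (rk_emb v'))) = rk_ip (rk_emb v) (rk_rep b (rk_emb v'))"
    by (simp add: pairing_def cross_def)
next
  let ?S = "complex_vector.span {rk_rep b (rk_emb v) | b v. True}"
  have "\<phi> \<in> rk_metric.mtopology closure_of ?S" if \<phi>: "\<phi> \<in> rk_module" for \<phi>
    unfolding rk_metric.metric_closure_of
  proof (intro CollectI conjI allI impI \<phi>)
    fix r :: real assume "0 < r"
    then have "\<exists>xs. bounded_by (\<phi> - ker xs) (r / 2)"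
      using \<phi> by (simp add: rk_module_def)
    then obtain xs where "bounded_by (\<phi> - ker xs) (r / 2)" by blast
    then have "hilbert_dist rk_module rk_ip \<phi> (ker xs) \<le> r / 2"
      using rk_dist_le_iff[OF \<phi> ker_mem] by blast
    with \<open>0 < r\<close> \<phi> show "\<exists>y\<in>?S. y \<in> rk_metric.mball \<phi> r"
      by (intro bexI[OF _ ker_mem_span[of xs]]) simp
  qed
  moreover have "rk_metric.mtopology closure_of ?S \<subseteq> rk_module"
    using closure_of_subset_topspace[of rk_metric.mtopology] by simp
  ultimately show "rk_metric.mtopology closure_of ?S = rk_module" by blast
qed

end


section \<open>Every minimal dilation is the reproducing kernel dilation\<close>

locale cp_dilation = cp_map actV E
  for actV :: "'v::complex_vector \<Rightarrow> 'a::cstar_algebra \<Rightarrow> 'v"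
    and E :: "'b::unital_cstar_algebra \<Rightarrow> 'v \<Rightarrow> 'v \<Rightarrow> 'a" +
  fixes M :: "'m::complex_vector set" and act ip \<pi> J
  assumes minimal: "minimal_dilation actV E M act ip \<pi> J"
begin

sublocale H: hilbert_module M act ip
  using minimal by (simp add: minimal_dilation_def)

sublocale H_metric: Metric_space M "hilbert_dist M ip"
  by (rule H.Metric_space_hilbert_dist)

lemma J_closed [simp]: "J v \<in> M"
  using minimal by (auto simp: minimal_dilation_def Lin_def)

lemma \<pi>_adjoint: "is_adjoint M ip (\<pi> b) (\<pi> (star b))"
  using minimal by (simp add: minimal_dilation_def unital_star_hom_def)

lemma \<pi>_closed [simp]: "x \<in> M \<Longrightarrow> \<pi> b x \<in> M"
  using \<pi>_adjoint[of b] by (auto simp: is_adjoint_def)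

lemma ip_\<pi>: "x \<in> M \<Longrightarrow> y \<in> M \<Longrightarrow> ip (\<pi> b x) y = ip x (\<pi> (star b) y)"
  using \<pi>_adjoint[of b] by (auto simp: is_adjoint_def)

lemma \<pi>_mult: "x \<in> M \<Longrightarrow> \<pi> (b * c) x = \<pi> b (\<pi> c x)"
  and \<pi>_one: "x \<in> M \<Longrightarrow> \<pi> 1 x = x"
  and \<pi>_scaleC: "x \<in> M \<Longrightarrow> \<pi> (k *\<^sub>C b) x = k *\<^sub>C \<pi> b x"
  using minimal by (simp_all add: minimal_dilation_def unital_star_hom_def)

lemma ip_J: "ip (J v) (\<pi> b (J w)) = E b v w"
  using minimal by (simp add: minimal_dilation_def)

lemma ip_\<pi>_J: "ip (\<pi> b (J v)) (\<pi> c (J w)) = E (star b * c) v w"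
  by (simp add: ip_\<pi> ip_J flip: \<pi>_mult)

definition vec :: "('b \<times> 'v) list \<Rightarrow> 'm"
  where "vec xs = (\<Sum>(b, v)\<leftarrow>xs. \<pi> b (J v))"

lemma vec_simps [simp]: "vec [] = 0" "vec ((b, v) # xs) = \<pi> b (J v) + vec xs"
  by (simp_all add: vec_def)

lemma vec_closed [simp]: "vec xs \<in> M"
  by (induction xs) auto

definition coord :: "'m \<Rightarrow> 'b \<Rightarrow> 'v \<Rightarrow> 'a"
  where "coord m = (\<lambda>b v. ip (\<pi> b (J v)) m)"

lemma coord_add: "m \<in> M \<Longrightarrow> n \<in> M \<Longrightarrow> coord (m + n) = coord m + coord n"
  by (simp add: fun_eq_iff coord_def H.ip_add_right)

lemma coord_diff: "m \<in> M \<Longrightarrow> n \<in> M \<Longrightarrow> coord (m - n) = coord m - coord n"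
  by (simp add: fun_eq_iff coord_def H.ip_diff_right)

lemma coord_scaleC: "m \<in> M \<Longrightarrow> coord (c *\<^sub>C m) = c *\<^sub>C coord m"
  by (simp add: fun_eq_iff coord_def H.ip_scaleC_right scaleC_fun_def)

lemma coord_act: "m \<in> M \<Longrightarrow> coord (act m a) = rk_act (coord m) a"
  by (simp add: fun_eq_iff coord_def H.ip_act_right rk_act_def)

lemma coord_\<pi>: "m \<in> M \<Longrightarrow> coord (\<pi> c m) = rk_rep c (coord m)"
  by (simp add: fun_eq_iff coord_def rk_rep_def ip_\<pi> \<pi>_mult star_mult star_star)

lemma coord_vec: "coord (vec xs) = ker xs"
proof (induction xs)
  case (Cons x xs)
  then show ?case by (cases x) (simp add: coord_add fun_eq_iff, simp add: coord_def ker_def ip_\<pi>_J)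
qed (simp add: coord_def fun_eq_iff)

lemma coord_J: "coord (J v) = rk_emb v"
  using coord_vec[of "[(1, v)]"] by (simp add: rk_emb_def \<pi>_one)

lemma ip_vec: "m \<in> M \<Longrightarrow> ip (vec xs) m = eval_list xs (coord m)"
  by (induction xs) (auto simp: H.ip_add_left coord_def)

lemma mnorm_vec: "H.mnorm (vec xs) = list_norm xs"
  by (simp add: H.mnorm_def ip_vec coord_vec list_norm_def gram_def)

lemma bounded_by_coord: "m \<in> M \<Longrightarrow> bounded_by (coord m) (H.mnorm m)"
  using H.Cauchy_Schwarz[OF vec_closed] by (simp add: bounded_by_def ip_vec mnorm_vec mult.commute)

lemma vec_surj_span:
  assumes "x \<in> complex_vector.span {\<pi> b (J v) | b v. True}"
  shows "\<exists>xs. x = vec xs"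
  using assms
proof (induction rule: complex_vector.span_induct_alt)
  case base
  show ?case by (rule exI[of _ "[]"]) simp
next
  case (step c x y)
  then obtain b v xs where "x = \<pi> b (J v)" "y = vec xs" by auto
  then have "c *\<^sub>C x + y = vec ((c *\<^sub>C b, v) # xs)" by (simp add: \<pi>_scaleC)
  then show ?case by blast
qed

lemma vec_dense:
  assumes "m \<in> M" "0 < e"
  shows "\<exists>xs. H.mnorm (m - vec xs) < e"
proof -
  have "m \<in> H_metric.mtopology closure_of complex_vector.span {\<pi> b (J v) | b v. True}"
    using assms(1) minimal by (simp add: minimal_dilation_def)
  then obtain y where y: "y \<in> complex_vector.span {\<pi> b (J v) | b v. True}" "y \<in> H_metric.mball m e"
    using assms(2) unfolding H_metric.metric_closure_of by blast
  then show ?thesis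
    using vec_surj_span[OF y(1)] assms(1) by (auto simp: H.hilbert_dist_eq)
qed

lemma vec_approximation:
  assumes "m \<in> M"
  obtains X where "approximates X (coord m)" "(\<lambda>k. H.mnorm (m - vec (X k))) \<longlonglongrightarrow> 0"
proof -
  have "\<exists>xs. H.mnorm (m - vec xs) < 1 / real (Suc k)" for k
    by (rule vec_dense[OF assms]) simp
  then obtain X where X: "\<And>k. H.mnorm (m - vec (X k)) < 1 / real (Suc k)" by metis
  have lim: "(\<lambda>k. H.mnorm (m - vec (X k))) \<longlonglongrightarrow> 0"
  proof (rule tendsto_sandwich[OF _ _ tendsto_const LIMSEQ_Suc[OF lim_1_over_n]])
    show "\<forall>\<^sub>F k in sequentially. 0 \<le> H.mnorm (m - vec (X k))" by simp
    show "\<forall>\<^sub>F k in sequentially. H.mnorm (m - vec (X k)) \<le> 1 / real (Suc k)"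
      using X by (simp add: less_imp_le)
  qed
  have "approximates X (coord m)"
  proof (rule approximatesI[OF _ lim])
    show "bounded_by (coord m - ker (X k)) (H.mnorm (m - vec (X k)))" for k
      using bounded_by_coord[of "m - vec (X k)"] assms by (simp add: coord_diff coord_vec)
  qed
  then show thesis using lim by (rule that)
qed

lemma coord_mem: "m \<in> M \<Longrightarrow> coord m \<in> rk_module"
  by (meson vec_approximation approximates_imp_mem)

text \<open>
  The identity holds by construction when \<open>m\<close> is one of the dense vectors \<open>\<Sum> \<pi>(b) J v\<close>, and both
  sides are continuous in \<open>m\<close>.
\<close>

lemma rk_ip_coord:
  assumes "m \<in> M" "n \<in> M"
  shows "rk_ip (coord m) (coord n) = ip m n"
proof -
  obtain X where X: "approximates X (coord m)" "(\<lambda>k. H.mnorm (m - vec (X k))) \<longlonglongrightarrow> 0"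
    using assms(1) by (rule vec_approximation)
  have "(\<lambda>k. ip m n - ip (vec (X k)) n) \<longlonglongrightarrow> 0"
  proof (rule Lim_null_comparison[OF always_eventually[OF allI]])
    show "norm (ip m n - ip (vec (X k)) n) \<le> H.mnorm (m - vec (X k)) * H.mnorm n" for k
      using H.Cauchy_Schwarz[of "m - vec (X k)" n] assms by (simp add: H.ip_diff_left)
    show "(\<lambda>k. H.mnorm (m - vec (X k)) * H.mnorm n) \<longlonglongrightarrow> 0"
      by (rule tendsto_mult_left_zero[OF X(2)])
  qed
  from tendsto_diff[OF tendsto_const this, of "ip m n"]
  have "(\<lambda>k. eval_list (X k) (coord n)) \<longlonglongrightarrow> ip m n"
    by (simp add: ip_vec assms)
  then show ?thesis by (rule LIMSEQ_unique[OF rk_ip_tendsto[OF coord_mem[OF assms(2)] X(1)]])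
qed

lemma inj_coord: "inj_on coord M"
proof (rule inj_onI)
  fix m n assume mn: "m \<in> M" "n \<in> M" "coord m = coord n"
  then have "coord (m - n) = 0" by (simp add: coord_diff)
  then have "ip (m - n) (m - n) = 0"
    using rk_ip_coord[of "m - n" "m - n"] mn by simp
  then show "m = n" using H.ip_definite[of "m - n"] mn by simp
qed

text \<open>
  Lists that approximate \<open>\<phi>\<close> give a Cauchy sequence of vectors in \<open>M\<close>, because \<open>m \<mapsto> coord m\<close> is
  isometric; completeness of \<open>M\<close> provides the preimage of \<open>\<phi>\<close>.
\<close>

lemma coord_surj:
  assumes "\<phi> \<in> rk_module"
  shows "\<phi> \<in> coord ` M"
proof -
  obtain X where X: "approximates X \<phi>" using assms by (rule rk_module_approximable)
  then obtain e where e: "e \<longlonglongrightarrow> 0" "\<And>n. bounded_by (\<phi> - ker (X n)) (e n)"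
    by (auto simp: approximates_def)
  have dist: "H.mnorm (vec (X k) - vec (X l)) \<le> e l + e k" for k l
  proof -
    have "bounded_by (ker (X k) - ker (X l)) (e l + e k)"
      using bounded_by_diff[OF e(2)[of l] e(2)[of k]] by simp
    moreover have "rk_ip (ker (X k) - ker (X l)) (ker (X k) - ker (X l))
        = ip (vec (X k) - vec (X l)) (vec (X k) - vec (X l))"
      by (subst rk_ip_coord[symmetric]) (simp_all add: coord_diff coord_vec)
    ultimately show ?thesis
      by (simp add: bounded_by_iff_rk_ip H.mnorm_def)
  qed
  have "H_metric.MCauchy (\<lambda>k. vec (X k))"
    unfolding H_metric.MCauchy_def
  proof (intro conjI allI impI)
    fix r :: real assume "0 < r"
    then have "\<forall>\<^sub>F n in sequentially. e n < r / 2"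
      by (intro order_tendstoD(2)[OF e(1)]) simp
    then obtain N where N: "\<And>n. N \<le> n \<Longrightarrow> e n < r / 2" by (auto simp: eventually_sequentially)
    have "hilbert_dist M ip (vec (X k)) (vec (X l)) < r" if "N \<le> k" "N \<le> l" for k l
      using dist[of k l] N[OF that(1)] N[OF that(2)] by (simp add: H.hilbert_dist_eq)
    then show "\<exists>N. \<forall>k l. N \<le> k \<longrightarrow> N \<le> l \<longrightarrow> hilbert_dist M ip (vec (X k)) (vec (X l)) < r"
      by blast
  qed auto
  then obtain m where m: "limitin H_metric.mtopology (\<lambda>k. vec (X k)) m sequentially"
    using H.complete by (auto simp: H_metric.mcomplete_def)
  then have "m \<in> M" by (simp add: H_metric.limit_metric_sequentially)
  have lim: "(\<lambda>k. H.mnorm (vec (X k) - m)) \<longlonglongrightarrow> 0"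
  proof (rule LIMSEQ_I)
    fix r :: real assume "0 < r"
    then show "\<exists>N. \<forall>k\<ge>N. norm (H.mnorm (vec (X k) - m) - 0) < r"
      using m \<open>m \<in> M\<close> by (auto simp: H_metric.limit_metric_sequentially H.hilbert_dist_eq)
  qed
  have "coord m b v = \<phi> b v" for b v
  proof -
    have "(\<lambda>k. ker (X k) b v - coord m b v) \<longlonglongrightarrow> 0"
    proof (rule Lim_null_comparison[OF always_eventually[OF allI]])
      show "norm (ker (X k) b v - coord m b v) \<le> H.mnorm (\<pi> b (J v)) * H.mnorm (vec (X k) - m)" for k
        using H.Cauchy_Schwarz[of "\<pi> b (J v)" "vec (X k) - m"] \<open>m \<in> M\<close>
        by (simp add: H.ip_diff_right coord_def flip: coord_vec)
      show "(\<lambda>k. H.mnorm (\<pi> b (J v)) * H.mnorm (vec (X k) - m)) \<longlonglongrightarrow> 0"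
        by (rule tendsto_mult_right_zero[OF lim])
    qed
    then show ?thesis by (rule LIMSEQ_unique[OF LIM_zero_cancel approximates_pointwise[OF X]])
  qed
  then have "coord m = \<phi>" by (simp add: fun_eq_iff)
  with \<open>m \<in> M\<close> show ?thesis by blast
qed

lemma bij_coord: "bij_betw coord M rk_module"
  using inj_coord coord_mem coord_surj by (auto simp: bij_betw_def)

end


section \<open>The dilation theorem\<close>

lemma minimal_dilations_unitarily_equivalent:
  assumes "cp_dilation actV E M act ip \<pi> J" and "cp_dilation actV E M' act' ip' \<pi>' J'"
  shows "\<exists>U. unitary_map M act ip M' act' ip' U \<and>
    (\<forall>b. \<forall>y\<in>M'. \<pi>' b y = U (\<pi> b (inv_into M U y))) \<and> (\<forall>v. J' v = U (J v))"
proof -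
  interpret D: cp_dilation actV E M act ip \<pi> J by fact
  interpret D': cp_dilation actV E M' act' ip' \<pi>' J' by fact
  define U where "U m = inv_into M' D'.coord (D.coord m)" for m
  have U_mem: "U m \<in> M'" and coord_U: "D'.coord (U m) = D.coord m" if "m \<in> M" for m
    using that D'.bij_coord D.coord_mem[OF that]
    by (auto simp: U_def bij_betw_def intro: inv_into_into f_inv_into_f)
  have U_eqI: "y = U m" if "y \<in> M'" "m \<in> M" "D'.coord y = D.coord m" for y m
    using that D'.inj_coord U_mem coord_U by (metis inj_onD)
  have U_image: "U ` M = M'"
  proof (intro equalityI subsetI)
    fix y assume y: "y \<in> M'"
    then obtain m where "m \<in> M" "D'.coord y = D.coord m"
      using D.coord_surj[OF D'.coord_mem[OF y]] by blast
    with U_eqI[OF y] show "y \<in> U ` M" by blast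
  qed (use U_mem in blast)
  have "U \<in> Lin M act M' act'"
    unfolding Lin_def
  proof (intro CollectI conjI ballI allI)
    show "U \<in> M \<rightarrow> M'" using U_mem by blast
    show "U (m + n) = U m + U n" if "m \<in> M" "n \<in> M" for m n
      using that by (intro U_eqI[symmetric]) (simp_all add: U_mem coord_U D.coord_add D'.coord_add)
    show "U (c *\<^sub>C m) = c *\<^sub>C U m" if "m \<in> M" for c m
      using that by (intro U_eqI[symmetric]) (simp_all add: U_mem coord_U D.coord_scaleC D'.coord_scaleC)
    show "U (act m a) = act' (U m) a" if "m \<in> M" for m a
      using that by (intro U_eqI[symmetric])
        (simp_all add: U_mem coord_U D.coord_act D'.coord_act D.H.act_closed D'.H.act_closed)
  qed
  moreover have "ip' (U m) (U n) = ip m n" if "m \<in> M" "n \<in> M" for m n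
    using that by (simp add: U_mem coord_U flip: D.rk_ip_coord D'.rk_ip_coord)
  ultimately have "unitary_map M act ip M' act' ip' U"
    using U_image by (simp add: unitary_map_def)
  moreover have "\<pi>' b y = U (\<pi> b (inv_into M U y))" if y: "y \<in> M'" for b y
  proof -
    define m where "m = inv_into M U y"
    have m: "m \<in> M" "U m = y"
      using y unfolding m_def U_image[symmetric] by (simp_all add: inv_into_into f_inv_into_f)
    have "\<pi>' b y = U (\<pi> b m)"
      using m y coord_U[OF m(1)] by (intro U_eqI) (simp_all add: D.coord_\<pi> D'.coord_\<pi>)
    then show ?thesis by (simp add: m_def)
  qed
  moreover have "J' v = U (J v)" for v
    by (rule U_eqI) (simp_all add: D.coord_J D'.coord_J)
  ultimately show ?thesis by blast
qed

theorem theorem4p3: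
  fixes actV :: "'v::complex_vector \<Rightarrow> 'a::cstar_algebra \<Rightarrow> 'v"
    and E :: "'b::unital_cstar_algebra \<Rightarrow> 'v \<Rightarrow> 'v \<Rightarrow> 'a"
  assumes "cstar_module UNIV actV"
    and "completely_positive actV E"
  shows "(\<exists>(M :: ('b \<Rightarrow> 'v \<Rightarrow> 'a) set) act ip \<pi> J. minimal_dilation actV E M act ip \<pi> J) \<and>
    (\<forall>(M :: 'm::complex_vector set) act ip \<pi> J (M' :: 'n::complex_vector set) act' ip' \<pi>' J'.
      minimal_dilation actV E M act ip \<pi> J \<and> minimal_dilation actV E M' act' ip' \<pi>' J' \<longrightarrow>
      (\<exists>U. unitary_map M act ip M' act' ip' U \<and>
        (\<forall>b. \<forall>y\<in>M'. \<pi>' b y = U (\<pi> b (inv_into M U y))) \<and>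
        (\<forall>v. J' v = U (J v))))"
proof -
  interpret cp_map actV E using assms by (rule cp_map.intro)
  have dil: "cp_dilation actV E M act ip \<pi> J" if "minimal_dilation actV E M act ip \<pi> J"
    for M :: "'k::complex_vector set" and act ip \<pi> J
    using that by unfold_locales
  show ?thesis
    using rk_minimal_dilation minimal_dilations_unitarily_equivalent[OF dil dil] by blast
qed

end
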